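(* Let $1/2<a\le b<1$, let $h:\mathbb{R}\to[a,b]$ be continuous, and let $X=\{X_n(H):H\in(1/2,1),\,n\in\mathbb{N}\}$ be a centered Gaussian field satisfying Assumptions (i) and (ii), with $R:[a,b]^2\to(0,\infty)$ the continuous function in Assumption (ii). For $N\ge 1$ and $t\ge 0$ put $$S_h^N(t)=\sum_{n=1}^{\lfloor Nt\rfloor}\frac{X_n(h(n/N))}{N^{h(n/N)}}.$$ Then, as $N\to\infty$, the finite-dimensional distributions of $S_h^N$ converge to those of a centered Gaussian process $\widetilde S_h=\{\widetilde S_h(t)\}_{t\ge0}$ with covariance given for all $t,s\ge 0$ by $$\mathbb{E}[\widetilde S_h(t)\widetilde S_h(s)]=\int_0^t d\theta\int_0^s d\sigma\,\mathcal{R}(\theta,\sigma;h(\theta),h(\sigma))\,|\theta-\sigma|^{h(\theta)+h(\sigma)-2},$$ where the integral on the right-hand side is always well defined.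
   Context: $\lfloor x\rfloor$ is the integer part of $x$. A centered Gaussian field is a family of random variables all of whose finite linear combinations are centered Gaussian. Assumption (i): for every $M>0$, the map $(j,k,H_1,H_2)\mapsto\mathbb{E}[X_j(H_1)X_k(H_2)]$ is bounded on $\{(j,k)\in\mathbb{N}^2:|j-k|\le M\}\times[a,b]^2$. Assumption (ii): there exists a continuous function $R:[a,b]^2\to(0,\infty)$ such that $$\lim_{j-k\to\infty}\ \sup_{(H_1,H_2)\in[a,b]^2}\left|(j-k)^{2-H_1-H_2}\,\mathbb{E}[X_j(H_1)X_k(H_2)]-R(H_1,H_2)\right|=0$$ (i.e. for every $\eta>0$ there is $M$ such that the supremum is $\le\eta$ for all $j,k\in\mathbb{N}$ with $j-k\ge M$). For $t,s\ge0$ and $H_1,H_2\in[a,b]$: $\mathcal{R}(t,s;H_1,H_2)=R(H_1,H_2)\mathbf 1_{t\ge s}+R(H_2,H_1)\mathbf 1_{t<s}$. *)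

theory Defs
  imports "HOL-Probability.Probability"
begin

text \<open>The point mass at 0 is the degenerate centered Gaussian law of variance 0.\<close>

definition centered_gaussian_rv :: "'w measure \<Rightarrow> ('w \<Rightarrow> real) \<Rightarrow> bool" where
  "centered_gaussian_rv M Y \<longleftrightarrow>
     Y \<in> borel_measurable M \<and>
     (distr M borel Y = return borel 0 \<or>
      (\<exists>\<sigma>>0. distributed M lborel Y (\<lambda>x. ennreal (normal_density 0 \<sigma> x))))"

definition centered_gaussian_field ::
    "'w measure \<Rightarrow> 'i set \<Rightarrow> ('i \<Rightarrow> 'w \<Rightarrow> real) \<Rightarrow> bool" where
  "centered_gaussian_field M I Y \<longleftrightarrow>
     (\<forall>J c. finite J \<and> J \<subseteq> I \<longrightarrow> centered_gaussian_rv M (\<lambda>\<omega>. \<Sum>i\<in>J. c i * Y i \<omega>))"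

text \<open>
  The discrete time \<open>n\<close> ranges over the positive integers: \<open>X 0\<close> is unconstrained.
\<close>

definition assumption_i ::
    "'w measure \<Rightarrow> real \<Rightarrow> real \<Rightarrow> (nat \<Rightarrow> real \<Rightarrow> 'w \<Rightarrow> real) \<Rightarrow> bool" where
  "assumption_i P a b X \<longleftrightarrow>
     (\<forall>M>0::real. bounded
        ((\<lambda>(j, k, H1, H2). prob_space.expectation P (\<lambda>\<omega>. X j H1 \<omega> * X k H2 \<omega>)) `
         {(j, k, H1, H2). 1 \<le> j \<and> 1 \<le> k \<and> \<bar>real j - real k\<bar> \<le> M \<and>
                          H1 \<in> {a..b} \<and> H2 \<in> {a..b}}))"

definition assumption_ii ::
    "'w measure \<Rightarrow> real \<Rightarrow> real \<Rightarrow> (nat \<Rightarrow> real \<Rightarrow> 'w \<Rightarrow> real) \<Rightarrow> (real \<times> real \<Rightarrow> real) \<Rightarrow> bool"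
where
  "assumption_ii P a b X R \<longleftrightarrow>
     continuous_on ({a..b} \<times> {a..b}) R \<and>
     (\<forall>z\<in>{a..b} \<times> {a..b}. 0 < R z) \<and>
     (\<forall>\<eta>>0. \<exists>M>0::real. \<forall>j\<ge>1. \<forall>k\<ge>1. real j - real k \<ge> M \<longrightarrow>
        (\<forall>H1\<in>{a..b}. \<forall>H2\<in>{a..b}.
           \<bar>(real j - real k) powr (2 - H1 - H2) *
              prob_space.expectation P (\<lambda>\<omega>. X j H1 \<omega> * X k H2 \<omega>) - R (H1, H2)\<bar> \<le> \<eta>))"

definition partial_sum_process ::
    "(nat \<Rightarrow> real \<Rightarrow> 'w \<Rightarrow> real) \<Rightarrow> (real \<Rightarrow> real) \<Rightarrow> nat \<Rightarrow> real \<Rightarrow> 'w \<Rightarrow> real" where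
  "partial_sum_process X h N t \<omega> =
     (\<Sum>n = 1..nat \<lfloor>real N * t\<rfloor>. X n (h (real n / real N)) \<omega> / real N powr h (real n / real N))"

definition calR :: "(real \<times> real \<Rightarrow> real) \<Rightarrow> real \<Rightarrow> real \<Rightarrow> real \<Rightarrow> real \<Rightarrow> real" where
  "calR R t s H1 H2 = (if t \<ge> s then R (H1, H2) else R (H2, H1))"

text \<open>
  On the null set \<open>\<theta> = \<sigma>\<close> the value is 0, since \<open>0 powr x = 0\<close>.
\<close>

definition limit_kernel ::
    "(real \<times> real \<Rightarrow> real) \<Rightarrow> (real \<Rightarrow> real) \<Rightarrow> real \<Rightarrow> real \<Rightarrow> real" where
  "limit_kernel R h \<theta> \<sigma> =
     calR R \<theta> \<sigma> (h \<theta>) (h \<sigma>) * \<bar>\<theta> - \<sigma>\<bar> powr (h \<theta> + h \<sigma> - 2)"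

text \<open>
  Finite-dimensional laws are indexed by finite sets \<open>J\<close> of times and live on the product
  space of functions \<open>J \<rightarrow> \<real>\<close>, represented by \<open>extensional\<close> functions as in \<open>Pi\<^sub>M\<close>.
\<close>

definition fin_dim_law ::
    "'w measure \<Rightarrow> ('t \<Rightarrow> 'w \<Rightarrow> real) \<Rightarrow> 't set \<Rightarrow> ('t \<Rightarrow> real) measure" where
  "fin_dim_law M S J = distr M (Pi\<^sub>M J (\<lambda>_. borel)) (\<lambda>\<omega>. \<lambda>t\<in>J. S t \<omega>)"

definition weakly_converges ::
    "'t set \<Rightarrow> (nat \<Rightarrow> ('t \<Rightarrow> real) measure) \<Rightarrow> ('t \<Rightarrow> real) measure \<Rightarrow> bool" where
  "weakly_converges J \<mu> \<nu> \<longleftrightarrow>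
     (\<forall>f. continuous_map (product_topology (\<lambda>_. euclideanreal) J) euclideanreal f \<and>
          bounded (f ` (\<Pi>\<^sub>E t\<in>J. UNIV)) \<longrightarrow>
          (\<lambda>N. integral\<^sup>L (\<mu> N) f) \<longlonglongrightarrow> integral\<^sup>L \<nu> f)"

definition fdd_converges ::
    "'t set \<Rightarrow> 'w measure \<Rightarrow> (nat \<Rightarrow> 't \<Rightarrow> 'w \<Rightarrow> real) \<Rightarrow>
     'v measure \<Rightarrow> ('t \<Rightarrow> 'v \<Rightarrow> real) \<Rightarrow> bool" where
  "fdd_converges T P S Q S' \<longleftrightarrow>
     (\<forall>J. finite J \<and> J \<subseteq> T \<longrightarrow>
        weakly_converges J (\<lambda>N. fin_dim_law P (S N) J) (fin_dim_law Q S' J))"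

end

theory Submission
  imports Defs
begin

text \<open>
  Every linear combination of the values of the partial sum process is a centered Gaussian
  variable, so convergence of the finite-dimensional laws reduces to convergence of covariances.
  The covariance of two partial sums is the integral over the plane of a step function that
  takes the value \<open>N\<^sup>2\<close> times a summand on each cell of side \<open>1/N\<close>. Assumptions (i) and (ii) together give
  \<open>\<bar>E X\<^sub>j(H\<^sub>1) X\<^sub>k(H\<^sub>2)\<bar> \<le> C (1 + \<bar>j - k\<bar>) powr (H\<^sub>1 + H\<^sub>2 - 2)\<close>. As \<open>\<bar>\<theta> - \<sigma>\<bar> \<le> (1 + \<bar>j - k\<bar>)/N\<close> for
  \<open>(\<theta>, \<sigma>)\<close> in the cell of \<open>(j, k)\<close> and the exponent is negative, the step functions are dominated by
  \<open>C (\<bar>\<theta> - \<sigma>\<bar> powr (2a - 2) + 1)\<close>, which is locally integrable because \<open>a > 1/2\<close>; dominated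
  convergence then yields the double integral. The limit covariance is positive semidefinite,
  being a limit of covariances, and the Gaussian process is obtained from it by the Kolmogorov
  extension theorem. Multivariate weak convergence and uniqueness of laws are read off from
  the expectations of \<open>cos\<close> of affine functions with the help of the Stone-Weierstrass theorem.
\<close>

section \<open>Approximation by trigonometric polynomials\<close>

text \<open>A varying parameter is tractable because Assumption (ii) is uniform in
  \<open>(H1, H2)\<close>: the values \<open>h (n/N)\<close> move with \<open>N\<close>, yet the
  normalised covariance stays within \<open>\<eta>\<close> of \<open>R\<close> at these moving
  arguments, and continuity of \<open>R\<close> and \<open>h\<close> does the rest. Assumption (ii)
  speaks only of \<open>j - k\<close> tending to plus infinity, while \<open>R\<close> may be
  asymmetric; the opposite half plane comes from exchanging the two factors in the expectation,
  which is the origin of \<open>calR\<close>. On the diagonal, where lags stay bounded, no pointwise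
  limit is available; it is a null set, and Assumption (i) enters through the domination. Variances
  may degenerate, for instance at time 0, so densities and inverse covariance matrices are avoided:
  laws are described by cosine integrals, which depend continuously on the variance down to 0, and
  Gaussian vectors are linear images of independent standard normal variables.\<close>

instance "fun" :: (type, t0_space) t0_space
proof
  fix f g :: "'a \<Rightarrow> 'b"
  assume "f \<noteq> g"
  then obtain i where "f i \<noteq> g i" by auto
  from t0_space_class.t0_space[OF this] obtain U where U: "open U \<and> \<not> (f i \<in> U \<longleftrightarrow> g i \<in> U)" ..
  show "\<exists>U. open U \<and> \<not> (f \<in> U \<longleftrightarrow> g \<in> U)"
    using open_vimage[OF conjunct1[OF U] continuous_on_product_coordinates[of i]] conjunct2[OF U]
    by (intro exI[of _ "(\<lambda>x. x i) -` U"]) simp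
qed

instance "fun" :: (type, t1_space) t1_space
proof
  fix f g :: "'a \<Rightarrow> 'b"
  assume "f \<noteq> g"
  then obtain i where "f i \<noteq> g i" by auto
  from t1_space[OF this] obtain U where "open U" "f i \<in> U" "g i \<notin> U"
    by (elim exE conjE)
  then show "\<exists>U. open U \<and> f \<in> U \<and> g \<notin> U"
    using open_vimage[OF _ continuous_on_product_coordinates[of i], of U] by fastforce
qed

text \<open>\<open>function_ring_on\<close>, and with it the Stone-Weierstrass theorem, asks for a
  Hausdorff type, here a function type with the product topology. Preimages under one coordinate
  separate the points; the two instances above supply the superclasses.\<close>

instance "fun" :: (type, t2_space) t2_space
proof
  fix f g :: "'a \<Rightarrow> 'b"
  assume "f \<noteq> g"
  then obtain i where "f i \<noteq> g i" by auto
  from hausdorff[OF this] obtain U V where "open U" "open V" "f i \<in> U" "g i \<in> V" "U \<inter> V = {}"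
    by (elim exE conjE)
  then show "\<exists>U V. open U \<and> open V \<and> f \<in> U \<and> g \<in> V \<and> U \<inter> V = {}"
    using open_vimage[OF _ continuous_on_product_coordinates[of i], of U]
      open_vimage[OF _ continuous_on_product_coordinates[of i], of V]
    by (intro exI[of _ "(\<lambda>x. x i) -` U"] exI[of _ "(\<lambda>x. x i) -` V"]) auto
qed

text \<open>The linear span of cosines of affine functions of the coordinates in \<open>J\<close>.
  The phase \<open>v\<close> supplies sines and constants without complex values. Products are left
  out because closure under them follows, and linear rules suit inductions on integrals.\<close>

inductive_set trig_polys :: "'i set \<Rightarrow> (('i \<Rightarrow> real) \<Rightarrow> real) set" for J where
  cos: "(\<lambda>x. cos ((\<Sum>j\<in>J. u j * x j) + v)) \<in> trig_polys J"
| add: "p \<in> trig_polys J \<Longrightarrow> q \<in> trig_polys J \<Longrightarrow> (\<lambda>x. p x + q x) \<in> trig_polys J"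
| scale: "p \<in> trig_polys J \<Longrightarrow> (\<lambda>x. c * p x) \<in> trig_polys J"

text \<open>The product-to-sum formula writes a product of two generators as half the sum of two
  generators; the nested inductions extend this bilinearly. Stone-Weierstrass needs this
  closure.\<close>

lemma trig_polys_mult:
  assumes "p \<in> trig_polys J" "q \<in> trig_polys J"
  shows "(\<lambda>x. p x * q x) \<in> trig_polys J"
  using assms
proof (induction p rule: trig_polys.induct)
  case (cos u v)
  from cos show ?case
  proof (induction q rule: trig_polys.induct)
    case (cos u' v')
    have "(\<lambda>x. cos ((\<Sum>j\<in>J. u j * x j) + v) * cos ((\<Sum>j\<in>J. u' j * x j) + v')) =
      (\<lambda>x. (1/2) * (cos ((\<Sum>j\<in>J. (u j - u' j) * x j) + (v - v')) + cos ((\<Sum>j\<in>J. (u j + u' j) * x j) + (v + v'))))"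
    proof
      fix x
      have "(\<Sum>j\<in>J. u j * x j) + v - ((\<Sum>j\<in>J. u' j * x j) + v') = (\<Sum>j\<in>J. (u j - u' j) * x j) + (v - v')"
        "(\<Sum>j\<in>J. u j * x j) + v + ((\<Sum>j\<in>J. u' j * x j) + v') = (\<Sum>j\<in>J. (u j + u' j) * x j) + (v + v')"
        by (simp_all add: sum_subtractf sum.distrib algebra_simps)
      then show "cos ((\<Sum>j\<in>J. u j * x j) + v) * cos ((\<Sum>j\<in>J. u' j * x j) + v') =
        (1/2) * (cos ((\<Sum>j\<in>J. (u j - u' j) * x j) + (v - v')) + cos ((\<Sum>j\<in>J. (u j + u' j) * x j) + (v + v')))"
        by (simp only: cos_times_cos)
    qed
    then show ?case by (simp only:) (intro trig_polys.intros)
  next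
    case (add p q)
    from trig_polys.add[OF add.IH] show ?case by (simp only: distrib_left)
  next
    case (scale p c)
    from trig_polys.scale[OF scale.IH, of c] show ?case by (simp only: mult.left_commute)
  qed
next
  case (add p q)
  from trig_polys.add[OF add.IH(1)[OF add.prems] add.IH(2)[OF add.prems]] show ?case by (simp only: distrib_right)
next
  case (scale p c)
  from trig_polys.scale[OF scale.IH[OF scale.prems], of c] show ?case by (simp only: mult.assoc)
qed

lemma trig_polys_const: "(\<lambda>x. c) \<in> trig_polys J"
  using trig_polys.scale[OF trig_polys.cos[where u = "\<lambda>_. 0" and v = 0], of c] by simp

lemma trig_polys_sin_coordinate:
  assumes "finite J" "i \<in> J"
  shows "(\<lambda>x. sin (c * x i)) \<in> trig_polys J"
proof -
  \<comment> \<open>The phase \<open>- pi/2\<close> turns the cosine into a sine, and the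
    coefficient vector picks out coordinate \<open>i\<close>.\<close>
  have "(\<lambda>x. cos ((\<Sum>j\<in>J. (if j = i then c else 0) * x j) + (- pi/2))) \<in> trig_polys J"
    by (rule trig_polys.cos)
  also have "(\<lambda>x. cos ((\<Sum>j\<in>J. (if j = i then c else 0) * x j) + (- pi/2))) = (\<lambda>x. sin (c * x i))"
  proof
    fix x :: "'a \<Rightarrow> real"
    have "(\<Sum>j\<in>J. (if j = i then c else 0) * x j) = (\<Sum>j\<in>J. (if j = i then c * x j else 0))"
      by (intro sum.cong) auto
    also have "\<dots> = c * x i" using assms by simp
    finally show "cos ((\<Sum>j\<in>J. (if j = i then c else 0) * x j) + (- pi/2)) = sin (c * x i)"
      by (simp add: cos_diff)
  qed
  finally show ?thesis .
qed

lemma trig_polys_bounded: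
  assumes "p \<in> trig_polys J"
  shows "\<exists>B. \<forall>x. \<bar>p x\<bar> \<le> B"
  using assms
proof induction
  case (cos u v)
  show ?case by (rule exI[of _ 1]) simp
next
  case (add p q)
  then obtain B C where "\<forall>x. \<bar>p x\<bar> \<le> B" "\<forall>x. \<bar>q x\<bar> \<le> C" by auto
  then show ?case by (intro exI[of _ "B + C"] allI order_trans[OF abs_triangle_ineq] add_mono) auto
next
  case (scale p c)
  then obtain B where "\<forall>x. \<bar>p x\<bar> \<le> B" by auto
  then show ?case by (intro exI[of _ "\<bar>c\<bar> * B"]) (auto simp: abs_mult mult_left_mono)
qed

lemma trig_polys_measurable:
  assumes "p \<in> trig_polys J"
  shows "p \<in> borel_measurable (Pi\<^sub>M J (\<lambda>_. borel))"
  using assms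
proof induction
  case (cos u v)
  show ?case by measurable
qed auto

text \<open>Members of the cube equal \<open>undefined\<close> outside \<open>J\<close>, so it is a
  full product whose remaining factors are singletons, and Tychonoff's theorem applies.\<close>

lemma compact_PiE_interval:
  "compact (PiE J (\<lambda>_. {l..u::real}) :: ('i \<Rightarrow> real) set)"
proof -
  have eq: "PiE J (\<lambda>_. {l..u}) = PiE UNIV (\<lambda>i. if i \<in> J then {l..u} else {undefined})"
    by (force simp: PiE_iff extensional_def split: if_splits)
  have "compactin (product_topology (\<lambda>_::'i. euclideanreal) UNIV) (PiE UNIV (\<lambda>i. if i \<in> J then {l..u} else {undefined}))"
    by (auto simp: compactin_PiE)
  then show ?thesis
    by (simp add: eq euclidean_product_topology)
qed

text \<open>Precomposing with the triangular wave \<open>arcsin \<circ> sin\<close> makes a continuous function periodic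
  without changing it on a given cube, so the approximating polynomial in the sines is
  controlled on the whole space and not only on the cube.\<close>

lemma trig_polys_approx:
  fixes f :: "('i \<Rightarrow> real) \<Rightarrow> real"
  assumes J: "finite J"
    and f: "continuous_map (product_topology (\<lambda>_. euclideanreal) J) euclideanreal f"
    and B: "\<And>x. x \<in> PiE J (\<lambda>_. UNIV) \<Longrightarrow> \<bar>f x\<bar> \<le> B"
    and L: "0 < L" and e: "0 < e"
  obtains p where "p \<in> trig_polys J"
    and "\<And>x. x \<in> PiE J (\<lambda>_. UNIV) \<Longrightarrow> \<bar>p x\<bar> \<le> B + e"
    and "\<And>x. x \<in> PiE J (\<lambda>_. {-L..L}) \<Longrightarrow> \<bar>f x - p x\<bar> \<le> e"
proof -
  let ?S = "PiE J (\<lambda>_. {-1..1::real})"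
  \<comment> \<open>This scale maps \<open>[-L, L]\<close> onto \<open>[-pi/2, pi/2]\<close>, where
    \<open>arcsin\<close> inverts \<open>sin\<close>.\<close>
  define c where "c = pi / (2 * L)"
  define fold_in where "fold_in y = (\<lambda>j\<in>J. arcsin (y j) / c)" for y :: "'i \<Rightarrow> real"
  define sines where "sines x = (\<lambda>j\<in>J. sin (c * x j))" for x :: "'i \<Rightarrow> real"
  have c: "0 < c" using L by (simp add: c_def)
  \<comment> \<open>Continuous functions on \<open>?S\<close> whose pullback along
    \<open>sines\<close> is a trigonometric polynomial. They form an algebra, and the coordinates,
    which pull back to \<open>sin (c * x j)\<close>, separate points.\<close>
  define A where "A = {g. continuous_on ?S g \<and> (\<lambda>x. g (sines x)) \<in> trig_polys J}"
  have coord: "continuous_on T (\<lambda>x::'i \<Rightarrow> real. x j)" for T j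
    by (rule continuous_on_subset[OF continuous_on_product_coordinates subset_UNIV])
  interpret function_ring_on A ?S
  proof
    show "compact ?S" by (rule compact_PiE_interval)
    fix x y :: "'i \<Rightarrow> real" assume xy: "x \<in> ?S" "y \<in> ?S" "x \<noteq> y"
    then obtain j where j: "j \<in> J" "x j \<noteq> y j" by (meson PiE_ext)
    have "(\<lambda>x. x j) \<in> A"
      using trig_polys_sin_coordinate[OF J j(1), of c] j(1) coord by (simp add: A_def sines_def)
    then show "\<exists>f\<in>A. f x \<noteq> f y" by (rule bexI[rotated]) (rule j(2))
  next
    fix f g assume "f \<in> A" "g \<in> A"
    then show "(\<lambda>x. f x + g x) \<in> A" "(\<lambda>x. f x * g x) \<in> A"
      by (simp_all add: A_def continuous_on_add continuous_on_mult trig_polys.add trig_polys_mult)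
  qed (simp_all add: A_def trig_polys_const)
  have "continuous_map (top_of_set ?S) (product_topology (\<lambda>_. euclideanreal) J) fold_in"
    unfolding continuous_map_componentwise
  proof (intro conjI ballI)
    show "fold_in ` topspace (top_of_set ?S) \<subseteq> extensional J"
      by (auto simp: fold_in_def)
    fix j assume j: "j \<in> J"
    have "continuous_on ?S (\<lambda>y. arcsin (y j) / c)"
      using j c by (intro continuous_intros coord) (auto simp: PiE_iff)
    then show "continuous_map (top_of_set ?S) euclideanreal (\<lambda>y. fold_in y j)"
      using j by (simp add: fold_in_def)
  qed
  from continuous_map_compose[OF this f]
  have "continuous_on ?S (f \<circ> fold_in)" by simp
  from Stone_Weierstrass_basic[OF this e]
  obtain g where g: "g \<in> A" "\<And>y. y \<in> ?S \<Longrightarrow> \<bar>(f \<circ> fold_in) y - g y\<bar> < e" by blast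
  have sines: "sines x \<in> ?S" for x by (auto simp: sines_def)
  show thesis
  proof
    show "(\<lambda>x. g (sines x)) \<in> trig_polys J" using g by (simp add: A_def)
    fix x :: "'i \<Rightarrow> real"
    \<comment> \<open>\<open>fold_in\<close> always lands in the domain where \<open>f\<close> is
      bounded by \<open>B\<close>, so the bound is available at points far outside the cube as
      well.\<close>
    { assume "x \<in> PiE J (\<lambda>_. UNIV)"
      have "\<bar>f (fold_in (sines x))\<bar> \<le> B" by (intro B) (auto simp: fold_in_def)
      then show "\<bar>g (sines x)\<bar> \<le> B + e" using g(2)[OF sines, of x] by simp }
    { assume x: "x \<in> PiE J (\<lambda>_. {-L..L})"
      have "fold_in (sines x) = x"
      proof
        fix j show "fold_in (sines x) j = x j"
        proof (cases "j \<in> J")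
          case True
          then have xj: "- L \<le> x j" "x j \<le> L" using x by (auto simp: PiE_iff)
          have "c * (- L) \<le> c * x j" "c * x j \<le> c * L"
            using xj c by (simp_all only: mult_left_mono less_imp_le)
          moreover have "c * L = pi / 2" using L by (simp add: c_def)
          ultimately have "arcsin (sin (c * x j)) = c * x j"
            by (intro arcsin_sin) auto
          then show ?thesis using True c by (simp add: fold_in_def sines_def)
        next
          case False
          then show ?thesis using x by (auto simp: fold_in_def PiE_iff extensional_def)
        qed
      qed
      then show "\<bar>f x - g (sines x)\<bar> \<le> e" using g(2)[OF sines, of x] by simp }
  qed
qed

section \<open>Weak convergence on finite products\<close>

text \<open>Trigonometric polynomials are measurable, and those within \<open>1/(n+1)\<close> of
  \<open>f\<close> on the cube of radius \<open>n+1\<close> converge to \<open>f\<close> everywhere,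
  since each point lies in all large cubes. The Borel sets of the product topology are never
  compared with \<open>Pi\<^sub>M\<close>.\<close>

lemma borel_measurable_continuous_map_product:
  fixes f :: "('i \<Rightarrow> real) \<Rightarrow> real"
  assumes J: "finite J"
    and f: "continuous_map (product_topology (\<lambda>_. euclideanreal) J) euclideanreal f"
    and bdd: "bounded (f ` (\<Pi>\<^sub>E j\<in>J. UNIV))"
  shows "f \<in> borel_measurable (Pi\<^sub>M J (\<lambda>_. borel))"
proof -
  obtain B where B: "\<And>x. x \<in> PiE J (\<lambda>_. UNIV) \<Longrightarrow> \<bar>f x\<bar> \<le> B"
    using bdd by (auto simp: bounded_iff)
  have "\<exists>p\<in>trig_polys J. \<forall>x\<in>PiE J (\<lambda>_. {- real (Suc n)..real (Suc n)}). \<bar>f x - p x\<bar> \<le> 1 / real (Suc n)" for n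
    using trig_polys_approx[OF J f B, of "real (Suc n)" "1 / real (Suc n)"] by (metis divide_pos_pos of_nat_0_less_iff zero_less_Suc zero_less_one)
  then obtain p where p: "\<And>n. p n \<in> trig_polys J"
    "\<And>n x. x \<in> PiE J (\<lambda>_. {- real (Suc n)..real (Suc n)}) \<Longrightarrow> \<bar>f x - p n x\<bar> \<le> 1 / real (Suc n)"
    by metis
  show ?thesis
  proof (rule borel_measurable_LIMSEQ_real)
    show "p n \<in> borel_measurable (Pi\<^sub>M J (\<lambda>_. borel))" for n
      by (rule trig_polys_measurable[OF p(1)])
    fix x :: "'i \<Rightarrow> real" assume "x \<in> space (Pi\<^sub>M J (\<lambda>_. borel))"
    then have x: "x \<in> extensional J" by (simp add: space_PiM PiE_iff)
    obtain m :: nat where m: "(\<Sum>j\<in>J. \<bar>x j\<bar>) \<le> real m" using real_arch_simple by blast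
    have "\<bar>f x - p n x\<bar> \<le> 1 / real (Suc n)" if "n \<ge> m" for n
    proof (rule p(2))
      have "x j \<in> {- real (Suc n)..real (Suc n)}" if "j \<in> J" for j
      proof -
        have "\<bar>x j\<bar> \<le> (\<Sum>j\<in>J. \<bar>x j\<bar>)" using J that by (intro member_le_sum) auto
        then show ?thesis using m \<open>n \<ge> m\<close> unfolding atLeastAtMost_iff by linarith
      qed
      then show "x \<in> PiE J (\<lambda>_. {- real (Suc n)..real (Suc n)})"
        using x by (simp add: PiE_iff del: atLeastAtMost_iff)
    qed
    then have "\<forall>\<^sub>F n in sequentially. norm (p n x - f x) \<le> 1 / real (Suc n)"
      by (auto simp: eventually_sequentially abs_minus_commute)
    then have "(\<lambda>n. p n x - f x) \<longlonglongrightarrow> 0"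
      using LIMSEQ_inverse_real_of_nat unfolding inverse_eq_divide by (rule Lim_null_comparison)
    then show "(\<lambda>n. p n x) \<longlonglongrightarrow> f x" by (simp add: LIM_zero_iff)
  qed
qed

definition outside_cube :: "'i set \<Rightarrow> real \<Rightarrow> ('i \<Rightarrow> real) set" where
  "outside_cube J L = {x \<in> PiE J (\<lambda>_. UNIV). \<exists>j\<in>J. L < \<bar>x j\<bar>}"

lemma sets_outside_cube [measurable]:
  assumes "finite J"
  shows "outside_cube J L \<in> sets (Pi\<^sub>M J (\<lambda>_. borel))"
proof -
  have "outside_cube J L = {x \<in> space (Pi\<^sub>M J (\<lambda>_. borel)). \<exists>j\<in>J. L < \<bar>x j\<bar>}"
    by (simp add: outside_cube_def space_PiM)
  also have "\<dots> \<in> sets (Pi\<^sub>M J (\<lambda>_. borel))"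
    using assms by measurable
  finally show ?thesis .
qed

text \<open>Replace \<open>f\<close> by a trigonometric polynomial close to it on a cube carrying
  most of the mass. Off the cube both functions stay bounded, so the tail mass controls the error,
  and \<open>conv\<close> handles the polynomial.\<close>

lemma weakly_converges_if_trig_tight:
  fixes \<mu> :: "nat \<Rightarrow> ('i \<Rightarrow> real) measure"
  assumes J: "finite J"
    and \<mu>: "\<And>N. prob_space (\<mu> N)" "\<And>N. sets (\<mu> N) = sets (Pi\<^sub>M J (\<lambda>_. borel))"
    and \<nu>: "prob_space \<nu>" "sets \<nu> = sets (Pi\<^sub>M J (\<lambda>_. borel))"
    and conv: "\<And>u v. (\<lambda>N. LINT x|\<mu> N. cos ((\<Sum>j\<in>J. u j * x j) + v)) \<longlonglongrightarrow>
                  (LINT x|\<nu>. cos ((\<Sum>j\<in>J. u j * x j) + v))"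
    and tight: "\<And>e. 0 < e \<Longrightarrow> \<exists>L>0. (\<forall>N. measure (\<mu> N) (outside_cube J L) \<le> e) \<and>
                  measure \<nu> (outside_cube J L) \<le> e"
  shows "weakly_converges J \<mu> \<nu>"
  unfolding weakly_converges_def
proof (intro allI impI, elim conjE)
  fix f :: "('i \<Rightarrow> real) \<Rightarrow> real"
  assume f: "continuous_map (product_topology (\<lambda>_. euclideanreal) J) euclideanreal f"
    and bdd: "bounded (f ` (\<Pi>\<^sub>E j\<in>J. UNIV))"
  have meas: "f \<in> borel_measurable (Pi\<^sub>M J (\<lambda>_. borel))"
    by (rule borel_measurable_continuous_map_product[OF J f bdd])
  obtain B where B: "\<And>x. x \<in> PiE J (\<lambda>_. UNIV) \<Longrightarrow> \<bar>f x\<bar> \<le> B" "0 \<le> B"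
  proof -
    obtain B where "\<And>x. x \<in> PiE J (\<lambda>_. UNIV) \<Longrightarrow> \<bar>f x\<bar> \<le> B" using bdd by (auto simp: bounded_iff)
    then have "\<And>x. x \<in> PiE J (\<lambda>_. UNIV) \<Longrightarrow> \<bar>f x\<bar> \<le> max B 0" by fastforce
    then show ?thesis using that[of "max B 0"] by simp
  qed
  have trig: "integrable M p" if p: "p \<in> trig_polys J" and "prob_space M" and M: "sets M = sets (Pi\<^sub>M J (\<lambda>_. borel))" for p M
  proof -
    interpret prob_space M by fact
    obtain C where "\<forall>x. \<bar>p x\<bar> \<le> C" using trig_polys_bounded[OF p] by auto
    moreover have "p \<in> borel_measurable M"
      using trig_polys_measurable[OF p] measurable_cong_sets[OF M refl] by blast
    ultimately show ?thesis by (intro integrable_const_bound[of _ C]) auto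
  qed
  have trig_conv: "(\<lambda>N. integral\<^sup>L (\<mu> N) p) \<longlonglongrightarrow> integral\<^sup>L \<nu> p" if "p \<in> trig_polys J" for p
    using that
  proof induction
    case (cos u v) then show ?case by (rule conv)
  next
    case (add p q)
    then show ?case using trig \<mu> \<nu> by (subst (1 2) Bochner_Integration.integral_add) (auto intro!: tendsto_add)
  next
    case (scale p c)
    then show ?case by (auto intro!: tendsto_mult)
  qed
  \<comment> \<open>The integrands differ by at most \<open>d\<close> inside the cube and by at most
    \<open>B + (B + d)\<close> outside.\<close>
  have diff: "\<bar>integral\<^sup>L M f - integral\<^sup>L M p\<bar> \<le> d + (2 * B + d) * measure M (outside_cube J L)"
    if M: "prob_space M" "sets M = sets (Pi\<^sub>M J (\<lambda>_. borel))" and d: "0 < d" and p: "p \<in> trig_polys J"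
      "\<And>x. x \<in> PiE J (\<lambda>_. UNIV) \<Longrightarrow> \<bar>p x\<bar> \<le> B + d"
      "\<And>x. x \<in> PiE J (\<lambda>_. {-L..L}) \<Longrightarrow> \<bar>f x - p x\<bar> \<le> d" for M d p L
  proof -
    interpret prob_space M by fact
    have sp: "space M = PiE J (\<lambda>_. UNIV)" using sets_eq_imp_space_eq[OF M(2)] by (simp add: space_PiM)
    have [measurable]: "f \<in> borel_measurable M" using meas measurable_cong_sets[OF M(2) refl] by blast
    have f_int: "integrable M f" using B by (intro integrable_const_bound[of _ B]) (auto simp: sp)
    have p_int: "integrable M p" by (rule trig[OF p(1) M])
    have out: "outside_cube J L \<in> sets M" using sets_outside_cube[OF J] M(2) by simp
    have "\<bar>integral\<^sup>L M f - integral\<^sup>L M p\<bar> = \<bar>LINT x|M. f x - p x\<bar>"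
      using f_int p_int by simp
    also have "\<dots> \<le> (LINT x|M. \<bar>f x - p x\<bar>)" by (rule integral_abs_bound)
    also have "\<dots> \<le> (LINT x|M. d + (2 * B + d) * indicator (outside_cube J L) x)"
    proof (rule integral_mono)
      show "integrable M (\<lambda>x. \<bar>f x - p x\<bar>)" using f_int p_int by auto
      show "integrable M (\<lambda>x. d + (2 * B + d) * indicator (outside_cube J L) x)"
        using out by (auto simp: emeasure_eq_measure)
      fix x assume "x \<in> space M"
      then have x: "x \<in> PiE J (\<lambda>_. UNIV)" by (simp add: sp)
      show "\<bar>f x - p x\<bar> \<le> d + (2 * B + d) * indicator (outside_cube J L) x"
      proof (cases "x \<in> outside_cube J L")
        case True
        then show ?thesis using B(1)[OF x] p(2)[OF x] d by simp
      next
        case False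
        then have "x \<in> PiE J (\<lambda>_. {-L..L})" using x
          by (force simp: outside_cube_def PiE_iff abs_le_iff not_less)
        then show ?thesis using p(3) False by simp
      qed
    qed
    also have "\<dots> = d + (2 * B + d) * measure M (outside_cube J L)"
      using out by (simp add: prob_space emeasure_eq_measure)
    finally show ?thesis .
  qed
  show "(\<lambda>N. integral\<^sup>L (\<mu> N) f) \<longlonglongrightarrow> integral\<^sup>L \<nu> f"
  proof (rule LIMSEQ_I)
    fix r :: real assume r: "0 < r"
    \<comment> \<open>Chosen so that \<open>d + (2 * B + d) * d\<close> is at most
      \<open>r / 4\<close>; two approximation errors and the limit error then add up to less than
      \<open>r\<close>.\<close>
    define d where "d = min 1 (r / (4 * (2 * B + 3)))"
    have d: "0 < d" "d \<le> 1" using r B(2) by (auto simp: d_def)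
    have "d \<le> r / (4 * (2 * B + 3))" by (simp add: d_def)
    then have "d * (4 * (2 * B + 3)) \<le> r" using B(2) by (simp add: pos_le_divide_eq)
    then have "12 * d + 8 * (B * d) \<le> r" by (simp add: algebra_simps)
    moreover have "d * d \<le> d" using d by simp
    moreover have "d + (2 * B + d) * d = d + 2 * (B * d) + d * d" by (simp add: algebra_simps)
    ultimately have small: "d + (2 * B + d) * d \<le> r / 4" using d by linarith
    obtain L where L: "L > 0" "\<And>N. measure (\<mu> N) (outside_cube J L) \<le> d" "measure \<nu> (outside_cube J L) \<le> d"
      using tight[OF d(1)] by auto
    obtain p where p: "p \<in> trig_polys J"
      "\<And>x. x \<in> PiE J (\<lambda>_. UNIV) \<Longrightarrow> \<bar>p x\<bar> \<le> B + d"
      "\<And>x. x \<in> PiE J (\<lambda>_. {-L..L}) \<Longrightarrow> \<bar>f x - p x\<bar> \<le> d"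
      using trig_polys_approx[OF J f B(1) L(1) d(1)] by blast
    have le: "\<bar>integral\<^sup>L M f - integral\<^sup>L M p\<bar> \<le> r / 4"
      if "prob_space M" "sets M = sets (Pi\<^sub>M J (\<lambda>_. borel))" "measure M (outside_cube J L) \<le> d" for M
    proof -
      have "(2 * B + d) * measure M (outside_cube J L) \<le> (2 * B + d) * d"
        using that(3) d(1) B(2) by (intro mult_left_mono) auto
      then show ?thesis using diff[where L = L, OF that(1,2) d(1) p] small by linarith
    qed
    obtain n0 where n0: "\<And>n. n \<ge> n0 \<Longrightarrow> \<bar>integral\<^sup>L (\<mu> n) p - integral\<^sup>L \<nu> p\<bar> < r / 4"
      using LIMSEQ_D[OF trig_conv[OF p(1)], of "r / 4"] r by auto
    have "\<bar>integral\<^sup>L (\<mu> n) f - integral\<^sup>L \<nu> f\<bar> < r" if "n \<ge> n0" for n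
      using le[OF \<mu> L(2), of n] le[OF \<nu> L(3)] n0[OF that] by linarith
    then show "\<exists>no. \<forall>n\<ge>no. norm (integral\<^sup>L (\<mu> n) f - integral\<^sup>L \<nu> f) < r" by auto
  qed
qed

section \<open>Uniqueness of laws from cosine integrals\<close>

lemma prob_space_tight:
  assumes J: "finite J" and M: "prob_space M" "sets M = sets (Pi\<^sub>M J (\<lambda>_. borel))" and e: "0 < e"
  shows "\<exists>L>0. measure M (outside_cube J L) \<le> e"
proof -
  interpret prob_space M by fact
  have "(\<lambda>n. measure M (outside_cube J (real n))) \<longlonglongrightarrow> measure M (\<Inter>n. outside_cube J (real n))"
  proof (rule finite_Lim_measure_decseq)
    show "range (\<lambda>n. outside_cube J (real n)) \<subseteq> sets M" using sets_outside_cube[OF J] M(2) by auto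
    show "decseq (\<lambda>n. outside_cube J (real n))"
      by (auto simp: decseq_def outside_cube_def) (meson le_less_trans of_nat_le_iff)
  qed
  also have "(\<Inter>n. outside_cube J (real n)) = {}"
  proof -
    { fix x assume x: "\<forall>n. \<exists>j\<in>J. real n < \<bar>x j\<bar>"
      obtain m :: nat where m: "(\<Sum>j\<in>J. \<bar>x j\<bar>) \<le> real m" using real_arch_simple by blast
      obtain j where "j \<in> J" "real m < \<bar>x j\<bar>" using x by blast
      then have False using member_le_sum[of j J "\<lambda>j. \<bar>x j\<bar>"] J m by simp }
    then show ?thesis by (fastforce simp: outside_cube_def)
  qed
  finally have "\<forall>\<^sub>F n in sequentially. measure M (outside_cube J (real n)) < e"
    using e by (intro order_tendstoD(2)[of _ "0::real"]) auto
  then obtain n0 where "\<And>n. n \<ge> n0 \<Longrightarrow> measure M (outside_cube J (real n)) < e"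
    by (auto simp: eventually_sequentially)
  from this[of "Suc n0"] show ?thesis by (intro exI[of _ "real (Suc n0)"]) auto
qed

text \<open>Lower orthants are closed under intersection and their indicators have continuous
  approximants, so they are a convenient generator for comparing laws. The fact \<open>P\<close>
  rewrites the generator that \<open>sets_PiM_sigma\<close> yields for the trivial cover
  \<open>{J}\<close> of \<open>J\<close>.\<close>

lemma sets_PiM_atMost:
  assumes J: "finite J"
  shows "sets (Pi\<^sub>M J (\<lambda>_. borel :: real measure)) =
    sigma_sets (PiE J (\<lambda>_. UNIV)) {PiE J (\<lambda>j. {..a j}) | a. True}"
proof -
  have P: "{{f\<in>(\<Pi>\<^sub>E i\<in>J. UNIV). \<forall>i\<in>j. f i \<in> A i} | A j. j \<in> {J} \<and> A \<in> Pi j (\<lambda>_. range (\<lambda>a::real. {..a}))}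
     = {PiE J (\<lambda>j. {..a j}) | a. True}" (is "?P = ?Q")
  proof (intro equalityI subsetI)
    fix S assume "S \<in> ?P"
    then obtain A where A: "A \<in> Pi J (\<lambda>_. range (\<lambda>a::real. {..a}))"
      and S: "S = {f\<in>(\<Pi>\<^sub>E i\<in>J. UNIV). \<forall>i\<in>J. f i \<in> A i}" by auto
    have "\<forall>i\<in>J. \<exists>a. A i = {..a}" using A by fastforce
    then obtain a where a: "\<And>i. i \<in> J \<Longrightarrow> A i = {..a i}" by metis
    have "S = PiE J (\<lambda>j. {..a j})" unfolding S using a by (auto simp: PiE_iff extensional_def)
    then show "S \<in> ?Q" by blast
  next
    fix S assume "S \<in> ?Q"
    then obtain a where S: "S = PiE J (\<lambda>j. {..a j})" by blast
    show "S \<in> ?P"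
      by (intro CollectI exI[of _ "\<lambda>j. {..a j}"] exI[of _ J]) (auto simp: S PiE_iff extensional_def)
  qed
  have "sets (Pi\<^sub>M J (\<lambda>_. sigma UNIV (range (\<lambda>a::real. {..a})))) =
    sets (sigma (PiE J (\<lambda>_. UNIV)) {{f\<in>(\<Pi>\<^sub>E i\<in>J. UNIV). \<forall>i\<in>j. f i \<in> A i} | A j. j \<in> {J} \<and> A \<in> Pi j (\<lambda>_. range (\<lambda>a::real. {..a}))})"
  proof (rule sets_PiM_sigma)
    show "\<exists>S\<subseteq>range (\<lambda>a::real. {..a}). countable S \<and> UNIV = \<Union> S" if "i \<in> J" for i
      by (rule exI[of _ "range (\<lambda>n::nat. {..real n})"]) (auto intro: real_arch_simple)
  qed (use J in auto)
  then show ?thesis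
    unfolding P borel_eq_atMost[symmetric] by (subst (asm) sets_measure_of) auto
qed

text \<open>The ramp is 1 up to \<open>a\<close> and, for positive \<open>n\<close>, falls linearly
  to 0 at \<open>a + 1/n\<close>: a continuous majorant of the indicator of the closed
  half-line.\<close>

lemma atMost_ramp_tendsto:
  fixes a x :: real
  shows "(\<lambda>n. max 0 (min 1 (1 - real n * (x - a)))) \<longlonglongrightarrow> indicator {..a} x"
proof (cases "x \<le> a")
  case True
  then have "real n * (x - a) \<le> 0" for n by (simp add: mult_le_0_iff)
  then show ?thesis using True by (auto simp: min_def max_def)
next
  case False
  obtain m :: nat where m: "1 / (x - a) \<le> real m" using real_arch_simple by blast
  have "max 0 (min 1 (1 - real n * (x - a))) = 0" if "n \<ge> m" for n
  proof -
    have "1 / (x - a) \<le> real n" using m that by linarith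
    then show ?thesis using False by (simp add: field_simps)
  qed
  then have "\<forall>\<^sub>F n in sequentially. max 0 (min 1 (1 - real n * (x - a))) = 0"
    by (auto simp: eventually_sequentially)
  then show ?thesis using False by (simp add: tendsto_eventually)
qed

text \<open>The constant sequence \<open>M\<close> converges weakly to \<open>N\<close>, since
  single laws are tight and the cosine integrals agree. So bounded continuous functions have equal
  integrals; products of ramps carry this over to lower orthants, which determine the law.\<close>

lemma measure_eqI_trig:
  fixes M N :: "('i \<Rightarrow> real) measure"
  assumes J: "finite J"
    and M: "prob_space M" "sets M = sets (Pi\<^sub>M J (\<lambda>_. borel))"
    and N: "prob_space N" "sets N = sets (Pi\<^sub>M J (\<lambda>_. borel))"
    and eq: "\<And>u v. (LINT x|M. cos ((\<Sum>j\<in>J. u j * x j) + v)) = (LINT x|N. cos ((\<Sum>j\<in>J. u j * x j) + v))"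
  shows "M = N"
proof -
  have weak: "weakly_converges J (\<lambda>_. M) N"
  proof (rule weakly_converges_if_trig_tight[OF J M N])
    fix e :: real assume "0 < e"
    then obtain L L' where L: "L > 0" "measure M (outside_cube J L) \<le> e" "measure N (outside_cube J L') \<le> e"
      using prob_space_tight[OF J M] prob_space_tight[OF J N] by blast
    interpret M: prob_space M by fact
    interpret N: prob_space N by fact
    have "outside_cube J (max L L') \<subseteq> outside_cube J L" "outside_cube J (max L L') \<subseteq> outside_cube J L'"
      by (auto simp: outside_cube_def)
    then have "measure M (outside_cube J (max L L')) \<le> measure M (outside_cube J L)"
      "measure N (outside_cube J (max L L')) \<le> measure N (outside_cube J L')"
      using sets_outside_cube[OF J] M(2) N(2)
      by (auto intro!: M.finite_measure_mono N.finite_measure_mono)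
    then show "\<exists>L>0. (\<forall>N::nat. measure M (outside_cube J L) \<le> e) \<and> measure N (outside_cube J L) \<le> e"
      using L by (intro exI[of _ "max L L'"]) auto
  qed (use eq in auto)
  interpret M: prob_space M by fact
  interpret N: prob_space N by fact
  have box: "emeasure M (PiE J (\<lambda>j. {..a j})) = emeasure N (PiE J (\<lambda>j. {..a j}))" for a :: "'i \<Rightarrow> real"
  proof -
    define g where "g n x = (\<Prod>j\<in>J. max 0 (min 1 (1 - real n * (x j - a j))))" for n and x :: "'i \<Rightarrow> real"
    have g01: "0 \<le> g n x" "g n x \<le> 1" for n x
      unfolding g_def by (auto intro!: prod_nonneg prod_le_1)
    have meas: "g n \<in> borel_measurable (Pi\<^sub>M J (\<lambda>_. borel))" for n
      unfolding g_def by measurable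
    have "integral\<^sup>L M (g n) = integral\<^sup>L N (g n)" for n
    proof -
      have "continuous_map (product_topology (\<lambda>_. euclideanreal) J) euclideanreal (g n)"
        unfolding g_def by (intro continuous_intros) (use J in auto)
      moreover have "bounded (g n ` (PiE J (\<lambda>_. UNIV)))"
        using g01 by (auto simp: bounded_iff intro!: exI[of _ 1])
      ultimately have "(\<lambda>_::nat. integral\<^sup>L M (g n)) \<longlonglongrightarrow> integral\<^sup>L N (g n)"
        using weak unfolding weakly_converges_def by blast
      then show ?thesis by (simp add: LIMSEQ_const_iff)
    qed
    moreover have "(\<lambda>n. integral\<^sup>L K (g n)) \<longlonglongrightarrow> measure K (PiE J (\<lambda>j. {..a j}))"
      if K: "prob_space K" "sets K = sets (Pi\<^sub>M J (\<lambda>_. borel))" for K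
    proof -
      interpret prob_space K by fact
      have sp: "space K = PiE J (\<lambda>_. UNIV)" using sets_eq_imp_space_eq[OF K(2)] by (simp add: space_PiM)
      have S: "PiE J (\<lambda>j. {..a j}) \<in> sets K" using J unfolding K(2) by (intro sets_PiM_I_finite) auto
      have "(\<lambda>n. integral\<^sup>L K (g n)) \<longlonglongrightarrow> (LINT x|K. indicator (PiE J (\<lambda>j. {..a j})) x)"
      proof (rule integral_dominated_convergence[where w = "\<lambda>_. 1"])
        show "AE x in K. (\<lambda>n. g n x) \<longlonglongrightarrow> indicator (PiE J (\<lambda>j. {..a j})) x"
        proof (rule AE_I2)
          fix x assume "x \<in> space K"
          then have ext: "x \<in> extensional J" by (simp add: sp PiE_iff)
          have "(\<lambda>n. g n x) \<longlonglongrightarrow> (\<Prod>j\<in>J. indicator {..a j} (x j))"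
            unfolding g_def by (intro tendsto_prod atMost_ramp_tendsto)
          also have "(\<Prod>j\<in>J. indicator {..a j} (x j)) = (indicator (PiE J (\<lambda>j. {..a j})) x :: real)"
            using J ext by (auto simp: indicator_def PiE_iff prod_zero_iff)
          finally show "(\<lambda>n. g n x) \<longlonglongrightarrow> indicator (PiE J (\<lambda>j. {..a j})) x" .
        qed
        show "g n \<in> borel_measurable K" for n using meas measurable_cong_sets[OF K(2) refl] by blast
      qed (use g01 S in auto)
      then show ?thesis using S by (simp add: sets.Int_space_eq2)
    qed
    ultimately have "measure M (PiE J (\<lambda>j. {..a j})) = measure N (PiE J (\<lambda>j. {..a j}))"
      using M N by (metis (no_types, lifting) LIMSEQ_unique ext)
    then show ?thesis by (simp add: M.emeasure_eq_measure N.emeasure_eq_measure)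
  qed
  show ?thesis
  proof (rule measure_eqI_generator_eq)
    let ?E = "{PiE J (\<lambda>j. {..a j}) | a :: 'i \<Rightarrow> real. True}"
    show "Int_stable ?E"
    proof (rule Int_stableI)
      fix A B assume "A \<in> ?E" "B \<in> ?E"
      then obtain a b where "A = PiE J (\<lambda>j. {..a j})" "B = PiE J (\<lambda>j. {..b j})" by blast
      then have "A \<inter> B = PiE J (\<lambda>j. {..min (a j) (b j)})" by (auto simp: PiE_iff)
      then show "A \<inter> B \<in> ?E" by (intro CollectI exI[of _ "\<lambda>j. min (a j) (b j)"]) simp
    qed
    show "?E \<subseteq> Pow (PiE J (\<lambda>_. UNIV))" by (auto simp: PiE_iff)
    show "sets M = sigma_sets (PiE J (\<lambda>_. UNIV)) ?E" "sets N = sigma_sets (PiE J (\<lambda>_. UNIV)) ?E"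
      using M(2) N(2) sets_PiM_atMost[OF J] by auto
    show "range (\<lambda>n. PiE J (\<lambda>j. {..real n})) \<subseteq> ?E" by auto
    show "(\<Union>n. PiE J (\<lambda>j. {..real n})) = PiE J (\<lambda>_. UNIV)"
    proof -
      { fix x :: "'i \<Rightarrow> real" assume x: "x \<in> PiE J (\<lambda>_. UNIV)"
        obtain m :: nat where m: "(\<Sum>j\<in>J. \<bar>x j\<bar>) \<le> real m" using real_arch_simple by blast
        have "x j \<le> real m" if "j \<in> J" for j
          using member_le_sum[of j J "\<lambda>j. \<bar>x j\<bar>"] J that m by simp
        then have "\<exists>n. x \<in> PiE J (\<lambda>j. {..real n})" using x by (auto simp: PiE_iff) }
      then show ?thesis by (auto simp: PiE_iff)
    qed
  qed (use box in \<open>auto simp: M.emeasure_eq_measure\<close>)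
qed

section \<open>Gaussian laws with a prescribed covariance\<close>

text \<open>\<open>V\<close> is the variance. An image of the standard normal law is used rather
  than a density, so that \<open>V = 0\<close> gives the point mass at 0 without a separate
  case.\<close>

definition normal_law :: "real \<Rightarrow> real measure" where
  "normal_law V = distr std_normal_distribution borel (\<lambda>x. sqrt V * x)"

lemma prob_space_std_normal: "prob_space std_normal_distribution"
  by (rule prob_space_normal_density) simp

lemma real_distribution_normal_law: "real_distribution (normal_law V)"
proof -
  interpret prob_space std_normal_distribution by (rule prob_space_std_normal)
  show ?thesis unfolding normal_law_def by (rule real_distribution_distr) simp
qed

lemma char_normal_law:
  assumes "0 \<le> V"
  shows "char (normal_law V) t = complex_of_real (exp (- (V * t\<^sup>2) / 2))"
proof -
  have "char (normal_law V) t = char std_normal_distribution (t * sqrt V)"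
    unfolding char_def normal_law_def by (subst integral_distr) (auto simp: mult.assoc)
  then show ?thesis
    using assms by (simp add: char_std_normal_distribution power_mult_distrib mult.commute)
qed

lemma normal_law_second_moment:
  assumes "0 \<le> V"
  shows "integrable (normal_law V) (\<lambda>x. x\<^sup>2)" "(LINT x|normal_law V. x\<^sup>2) = V"
  using std_normal_distribution_even_moments[of 1] assms
  by (simp_all add: normal_law_def integrable_distr_eq integral_distr power_mult_distrib)

text \<open>The integrals of \<open>cos\<close> and \<open>sin\<close> are the real and imaginary
  parts of the characteristic function at 1; the second vanishes because this function is real. The
  addition theorem inserts the phase.\<close>

lemma LINT_cos_normal_law:
  assumes "0 \<le> V"
  shows "(LINT x|normal_law V. cos (x + v)) = cos v * exp (- V / 2)"
proof -
  interpret real_distribution "normal_law V" by (rule real_distribution_normal_law)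
  have int: "integrable (normal_law V) cos" "integrable (normal_law V) sin"
    by (auto intro!: integrable_const_bound[of _ 1])
  have iexp: "iexp x = Complex (cos x) (sin x)" for x
    by (simp add: complex_eq_iff Re_exp Im_exp)
  have "integrable (normal_law V) (\<lambda>x. iexp x)"
    by (rule integrable_iexp) auto
  then have "(LINT x|normal_law V. cos x) = Re (char (normal_law V) 1)"
    "(LINT x|normal_law V. sin x) = Im (char (normal_law V) 1)"
    unfolding char_def
    by (simp_all only: integral_Re[symmetric] integral_Im[symmetric] mult_1 of_real_1)
      (simp_all add: iexp)
  then have "(LINT x|normal_law V. cos x) = exp (- V / 2)" "(LINT x|normal_law V. sin x) = 0"
    using assms by (simp_all add: char_normal_law)
  then show ?thesis
    using int by (simp add: cos_add)
qed

lemma density_normal_eq_normal_law: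
  assumes "0 < \<sigma>"
  shows "density lborel (\<lambda>x. ennreal (normal_density 0 \<sigma> x)) = normal_law (\<sigma>\<^sup>2)"
proof -
  interpret prob_space std_normal_distribution by (rule prob_space_std_normal)
  have "distributed std_normal_distribution lborel (\<lambda>x. x) std_normal_density"
    by (auto simp: distributed_def intro!: distr_id2)
  from normal_density_affine[OF this, of \<sigma> 0]
  have "distr std_normal_distribution lborel (\<lambda>x. \<sigma> * x) = density lborel (\<lambda>x. ennreal (normal_density 0 \<sigma> x))"
    using assms by (simp add: distributed_def)
  then show ?thesis
    using assms by (simp add: normal_law_def cong: distr_cong)
qed

lemma normal_law_0: "normal_law 0 = return borel 0"
proof -
  interpret prob_space std_normal_distribution by (rule prob_space_std_normal)
  show ?thesis by (simp add: normal_law_def distr_const)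
qed

lemma centered_gaussian_rv_iff_normal_law:
  "centered_gaussian_rv M Y \<longleftrightarrow>
     Y \<in> borel_measurable M \<and> (\<exists>V\<ge>0. distr M borel Y = normal_law V)"
proof -
  have lb: "distr M lborel Y = distr M borel Y"
    by (rule distr_cong) auto
  have "(\<exists>\<sigma>>0. distributed M lborel Y (\<lambda>x. ennreal (normal_density 0 \<sigma> x))) \<longleftrightarrow>
      (\<exists>\<sigma>>0. distr M borel Y = normal_law (\<sigma>\<^sup>2))" if "Y \<in> borel_measurable M"
    using that by (auto simp: distributed_def lb density_normal_eq_normal_law)
  also have "(\<exists>\<sigma>>0. distr M borel Y = normal_law (\<sigma>\<^sup>2)) \<longleftrightarrow> (\<exists>V>0. distr M borel Y = normal_law V)"
    by (metis real_sqrt_gt_zero real_sqrt_pow2 less_imp_le zero_less_power)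
  finally show ?thesis
    unfolding centered_gaussian_rv_def normal_law_0[symmetric] by (metis le_less order_refl)
qed

text \<open>Since \<open>normal_law V\<close> has second moment \<open>V\<close>, a centered
  Gaussian law is determined by its second moment; this is how convergence of laws becomes
  convergence of covariances.\<close>

lemma centered_gaussian_rv_second_moment:
  assumes "centered_gaussian_rv M Y"
  shows "integrable M (\<lambda>\<omega>. (Y \<omega>)\<^sup>2)" "distr M borel Y = normal_law (LINT \<omega>|M. (Y \<omega>)\<^sup>2)"
proof -
  obtain V where Y: "Y \<in> borel_measurable M" and V: "0 \<le> V" "distr M borel Y = normal_law V"
    using assms by (auto simp: centered_gaussian_rv_iff_normal_law)
  show "integrable M (\<lambda>\<omega>. (Y \<omega>)\<^sup>2)"
    using normal_law_second_moment(1)[OF V(1)] Y unfolding V(2)[symmetric]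
    by (simp add: integrable_distr_eq)
  have "(LINT \<omega>|M. (Y \<omega>)\<^sup>2) = V"
    using normal_law_second_moment(2)[OF V(1)] Y unfolding V(2)[symmetric]
    by (simp add: integral_distr)
  with V show "distr M borel Y = normal_law (LINT \<omega>|M. (Y \<omega>)\<^sup>2)" by simp
qed

lemma centered_gaussian_rv_cos:
  assumes "centered_gaussian_rv M Y"
  shows "(LINT \<omega>|M. cos (Y \<omega> + v)) = cos v * exp (- (LINT \<omega>|M. (Y \<omega>)\<^sup>2) / 2)"
proof -
  have [measurable]: "Y \<in> borel_measurable M"
    using assms by (simp add: centered_gaussian_rv_def)
  have "(LINT \<omega>|M. cos (Y \<omega> + v)) = (LINT x|distr M borel Y. cos (x + v))"
    by (subst integral_distr) auto
  then show ?thesis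
    unfolding centered_gaussian_rv_second_moment(2)[OF assms] by (simp add: LINT_cos_normal_law)
qed

section \<open>Factorization of positive semidefinite kernels\<close>

definition quad_form :: "('i \<Rightarrow> 'i \<Rightarrow> real) \<Rightarrow> 'i set \<Rightarrow> ('i \<Rightarrow> real) \<Rightarrow> real" where
  "quad_form K J u = (\<Sum>i\<in>J. \<Sum>j\<in>J. u i * u j * K i j)"

lemma quad_form_extend:
  assumes "finite H" "J \<subseteq> H"
  shows "quad_form K H (\<lambda>i. if i \<in> J then u i else 0) = quad_form K J u"
proof -
  have "(\<Sum>i\<in>H. \<Sum>j\<in>H. (if i \<in> J then u i else 0) * (if j \<in> J then u j else 0) * K i j)
      = (\<Sum>i\<in>J. \<Sum>j\<in>J. (if i \<in> J then u i else 0) * (if j \<in> J then u j else 0) * K i j)"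
    using assms by (intro sum.mono_neutral_cong_right ballI sum.neutral) auto
  also have "\<dots> = (\<Sum>i\<in>J. \<Sum>j\<in>J. u i * u j * K i j)"
    by (intro sum.cong) auto
  finally show ?thesis by (simp add: quad_form_def)
qed

lemma quad_form_insert:
  assumes "finite F" "x \<notin> F" "\<And>i. i \<in> F \<Longrightarrow> K x i = K i x"
  shows "quad_form K (insert x F) c =
    (c x)\<^sup>2 * K x x + 2 * c x * (\<Sum>i\<in>F. c i * K i x) + quad_form K F c"
proof -
  have "(\<Sum>j\<in>F. c x * c j * K x j) = c x * (\<Sum>i\<in>F. c i * K i x)"
    using assms(3) by (simp add: sum_distrib_left mult.assoc)
  moreover have "(\<Sum>i\<in>F. c i * c x * K i x) = c x * (\<Sum>i\<in>F. c i * K i x)"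
    by (simp add: sum_distrib_left mult_ac)
  ultimately show ?thesis
    using assms(1,2) by (simp add: quad_form_def sum.distrib power2_eq_square)
qed

text \<open>Cholesky elimination: split off the row and column of \<open>x\<close> and factor the
  Schur complement \<open>K'\<close> on the other indices. If the pivot \<open>K x x\<close> is 0,
  its whole column vanishes, and division by 0 giving 0 keeps the same formulas valid.\<close>

lemma psd_factorization:
  assumes "finite J"
    and "\<And>i j. i \<in> J \<Longrightarrow> j \<in> J \<Longrightarrow> K i j = K j i"
    and "\<And>c. 0 \<le> quad_form K J c"
  shows "\<exists>A::'i \<Rightarrow> 'i \<Rightarrow> real. \<forall>i\<in>J. \<forall>j\<in>J. K i j = (\<Sum>k\<in>J. A i k * A j k)"
  using assms
proof (induction J arbitrary: K rule: finite_induct)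
  case empty
  then show ?case by simp
next
  case (insert x F)
  have qf: "quad_form K (insert x F) c =
      (c x)\<^sup>2 * K x x + 2 * c x * (\<Sum>i\<in>F. c i * K i x) + quad_form K F c" for c
    by (intro quad_form_insert insert)  (use insert in auto)
  have Kxx: "0 \<le> K x x"
    using insert.prems(2)[of "\<lambda>i. if i = x then 1 else 0"] insert.hyps
    by (simp add: qf quad_form_def sum.neutral cong: sum.cong)
  have null: "K i x = 0" if i: "i \<in> F" and 0: "K x x = 0" for i
  proof (rule ccontr)
    assume ne: "K i x \<noteq> 0"
    \<comment> \<open>With a zero pivot the form at \<open>c\<close> is
      \<open>2 * c x * K i x + K i i\<close>; this value of \<open>c x\<close> makes it
      \<open>- 1\<close>.\<close>
    define c where "c j = (if j = x then - (K i i + 1) / (2 * K i x) else if j = i then 1 else 0)" for j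
    have "i \<noteq> x" using i insert.hyps by auto
    have "(\<Sum>j\<in>F. c j * K j x) = (\<Sum>j\<in>F. if j = i then K i x else 0)"
      using insert.hyps by (intro sum.cong) (auto simp: c_def)
    then have 1: "(\<Sum>j\<in>F. c j * K j x) = K i x" using i insert.hyps by simp
    have "quad_form K F c = (\<Sum>j\<in>F. \<Sum>k\<in>F. if k = i then (if j = i then K i i else 0) else 0)"
      unfolding quad_form_def using insert.hyps by (intro sum.cong) (auto simp: c_def)
    then have 2: "quad_form K F c = K i i" using i insert.hyps by simp
    have "quad_form K (insert x F) c = - 1"
      unfolding qf 1 2 using 0 ne by (simp add: c_def field_simps)
    then show False using insert.prems(2)[of c] by simp
  qed
  define K' where "K' i j = K i j - K i x * K j x / K x x" for i j
  have qf': "quad_form K' F c = quad_form K F c - (\<Sum>i\<in>F. c i * K i x)\<^sup>2 / K x x" for c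
    unfolding quad_form_def K'_def power2_eq_square sum_product sum_divide_distrib
      sum_subtractf[symmetric]
    by (intro sum.cong) (auto simp: algebra_simps)
  have "\<exists>A. \<forall>i\<in>F. \<forall>j\<in>F. K' i j = (\<Sum>k\<in>F. A i k * A j k)"
  proof (rule insert.IH)
    show "K' i j = K' j i" if "i \<in> F" "j \<in> F" for i j
      using that insert.prems(1)[of i j] by (simp add: K'_def)
    show "0 \<le> quad_form K' F c" for c
    proof -
      define s where "s = (\<Sum>i\<in>F. c i * K i x)"
      \<comment> \<open>For a positive pivot this value minimises the form in the coordinate
        \<open>x\<close>; the minimum is the form of the Schur complement, which is therefore
        nonnegative.\<close>
      define d where "d = c(x := - s / K x x)"
      have "(\<Sum>i\<in>F. d i * K i x) = s" "quad_form K F d = quad_form K F c"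
        unfolding s_def quad_form_def d_def using insert.hyps by (auto intro!: sum.cong)
      then have "quad_form K (insert x F) d = (s / K x x)\<^sup>2 * K x x - 2 * (s / K x x) * s + quad_form K F c"
        unfolding qf by (simp add: d_def)
      also have "\<dots> = quad_form K' F c"
        unfolding qf' s_def[symmetric] by (cases "K x x = 0") (auto simp: field_simps power2_eq_square)
      finally show ?thesis using insert.prems(2)[of d] by simp
    qed
  qed
  then obtain A where A: "\<And>i j. i \<in> F \<Longrightarrow> j \<in> F \<Longrightarrow> K' i j = (\<Sum>k\<in>F. A i k * A j k)" by blast
  \<comment> \<open>Column \<open>x\<close> carries the eliminated part divided by the root of the
    pivot; the other columns are those of \<open>A\<close>, with 0 in row \<open>x\<close>.\<close>
  define B where "B i k = (if k = x then (if i = x then sqrt (K x x) else K i x / sqrt (K x x))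
      else if i = x then 0 else A i k)" for i k
  have BF: "(\<Sum>k\<in>F. B i k * B j k) = (if i = x \<or> j = x then 0 else \<Sum>k\<in>F. A i k * A j k)" for i j
    using insert.hyps by (auto simp: B_def intro!: sum.cong sum.neutral)
  have "K i j = (\<Sum>k\<in>insert x F. B i k * B j k)" if i: "i \<in> insert x F" and j: "j \<in> insert x F" for i j
  proof -
    have root: "sqrt (K x x) * sqrt (K x x) = K x x" using Kxx by simp
    consider "i = x" "j = x" | "i = x" "j \<in> F" "j \<noteq> x" | "i \<in> F" "i \<noteq> x" "j = x"
      | "i \<in> F" "j \<in> F" "i \<noteq> x" "j \<noteq> x"
      using i j insert.hyps by auto
    then show ?thesis
    proof cases
      case 1
      then show ?thesis using insert.hyps root by (simp add: BF) (simp add: B_def)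
    next
      case 2
      then have "K x j = K j x" using insert.prems(1) by auto
      then show ?thesis using 2 insert.hyps null[of j] by (simp add: BF) (auto simp: B_def)
    next
      case 3
      then show ?thesis using insert.hyps null[of i] by (simp add: BF) (auto simp: B_def)
    next
      case 4
      then show ?thesis using insert.hyps A[of i j] root by (simp add: BF) (simp add: B_def K'_def)
    qed
  qed
  then show ?case by blast
qed

text \<open>The image, under a factor \<open>A\<close> of \<open>K\<close>, of independent standard
  normal variables indexed by \<open>J\<close> itself. Independence makes the characteristic
  function of a linear combination a product of Gaussian ones, and Levy's uniqueness theorem
  identifies the law.\<close>

lemma ex_gaussian_law_finite:
  fixes K :: "'i \<Rightarrow> 'i \<Rightarrow> real"
  assumes J: "finite J"
    and "\<And>i j. i \<in> J \<Longrightarrow> j \<in> J \<Longrightarrow> K i j = K j i"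
    and psd: "\<And>c. 0 \<le> quad_form K J c"
  shows "\<exists>P. prob_space P \<and> sets P = sets (Pi\<^sub>M J (\<lambda>_. borel)) \<and>
    (\<forall>u. distr P borel (\<lambda>x. \<Sum>j\<in>J. u j * x j) = normal_law (quad_form K J u))"
proof -
  obtain A where A: "\<And>i j. i \<in> J \<Longrightarrow> j \<in> J \<Longrightarrow> K i j = (\<Sum>k\<in>J. A i k * A j k)"
    using psd_factorization[OF assms] by blast
  define \<Omega> where "\<Omega> = Pi\<^sub>M J (\<lambda>_. std_normal_distribution)"
  define Y where "Y z = (\<lambda>i\<in>J. \<Sum>k\<in>J. A i k * z k)" for z
  define P where "P = distr \<Omega> (Pi\<^sub>M J (\<lambda>_. borel)) Y"
  interpret product_prob_space "\<lambda>_. std_normal_distribution" J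
    by (intro product_prob_spaceI prob_space_std_normal)
  interpret \<Omega>: prob_space \<Omega> unfolding \<Omega>_def by (intro prob_space_PiM prob_space_std_normal)
  have coord [measurable]: "(\<lambda>z. z k) \<in> borel_measurable \<Omega>" if "k \<in> J" for k
  proof -
    have "(\<lambda>z. z k) \<in> measurable \<Omega> std_normal_distribution"
      unfolding \<Omega>_def by (rule measurable_component_singleton[OF that])
    then show ?thesis by simp
  qed
  have Y [measurable]: "Y \<in> measurable \<Omega> (Pi\<^sub>M J (\<lambda>_. borel))"
    unfolding Y_def by (intro measurable_restrict borel_measurable_sum borel_measurable_times) auto
  interpret law: prob_space P unfolding P_def by (rule \<Omega>.prob_space_distr[OF Y])
  have "distr P borel (\<lambda>x. \<Sum>j\<in>J. u j * x j) = normal_law (quad_form K J u)" for u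
  proof -
    \<comment> \<open>Coefficients of the combination in the independent coordinates; their squares
      add up to the variance \<open>quad_form K J u\<close>.\<close>
    define b where "b k = (\<Sum>j\<in>J. u j * A j k)" for k
    have lin: "(\<Sum>j\<in>J. u j * Y z j) = (\<Sum>k\<in>J. b k * z k)" for z
    proof -
      have "(\<Sum>j\<in>J. u j * Y z j) = (\<Sum>j\<in>J. \<Sum>k\<in>J. u j * (A j k * z k))"
        by (intro sum.cong) (auto simp: Y_def sum_distrib_left)
      also have "\<dots> = (\<Sum>k\<in>J. \<Sum>j\<in>J. u j * (A j k * z k))" by (rule sum.swap)
      finally show ?thesis by (simp add: b_def sum_distrib_right mult.assoc)
    qed
    have sq: "(\<Sum>k\<in>J. (b k)\<^sup>2) = quad_form K J u"
    proof -
      have "(\<Sum>k\<in>J. (b k)\<^sup>2) = (\<Sum>k\<in>J. \<Sum>i\<in>J. \<Sum>j\<in>J. u i * u j * (A i k * A j k))"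
        by (simp add: b_def power2_eq_square sum_product mult_ac)
      also have "\<dots> = (\<Sum>i\<in>J. \<Sum>k\<in>J. \<Sum>j\<in>J. u i * u j * (A i k * A j k))" by (rule sum.swap)
      also have "\<dots> = (\<Sum>i\<in>J. \<Sum>j\<in>J. \<Sum>k\<in>J. u i * u j * (A i k * A j k))"
        by (intro sum.cong refl sum.swap)
      also have "\<dots> = quad_form K J u"
        unfolding quad_form_def by (intro sum.cong) (auto simp: A sum_distrib_left)
      finally show ?thesis .
    qed
    have [measurable]: "(\<lambda>z. \<Sum>k\<in>J. b k * z k) \<in> borel_measurable \<Omega>"
      by (intro borel_measurable_sum borel_measurable_times) auto
    have distr: "distr P borel (\<lambda>x. \<Sum>j\<in>J. u j * x j) = distr \<Omega> borel (\<lambda>z. \<Sum>k\<in>J. b k * z k)"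
      unfolding P_def by (subst distr_distr) (auto simp: comp_def lin)
    have "char (distr \<Omega> borel (\<lambda>z. \<Sum>k\<in>J. b k * z k)) t = char (normal_law (quad_form K J u)) t" for t
    proof -
      have "char (distr \<Omega> borel (\<lambda>z. \<Sum>k\<in>J. b k * z k)) t = (LINT z|\<Omega>. iexp (t * (\<Sum>k\<in>J. b k * z k)))"
        unfolding char_def by (subst integral_distr) auto
      also have "\<dots> = (LINT z|\<Omega>. (\<Prod>k\<in>J. iexp (t * b k * z k)))"
        by (simp add: sum_distrib_left exp_sum[OF J, symmetric] mult_ac)
      also have "\<dots> = (\<Prod>k\<in>J. (LINT x|std_normal_distribution. iexp (t * b k * x)))"
        unfolding \<Omega>_def
        by (intro product_integral_prod J prob_space.integrable_iexp prob_space_std_normal) auto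
      also have "\<dots> = (\<Prod>k\<in>J. complex_of_real (exp (- ((t * b k)\<^sup>2) / 2)))"
        by (simp only: char_def[symmetric] char_std_normal_distribution)
      also have "\<dots> = complex_of_real (exp (\<Sum>k\<in>J. - ((t * b k)\<^sup>2) / 2))"
        by (simp add: exp_sum[OF J])
      also have "(\<Sum>k\<in>J. - ((t * b k)\<^sup>2) / 2) = - (quad_form K J u * t\<^sup>2) / 2"
        by (simp add: sq[symmetric] sum_negf sum_distrib_left sum_distrib_right power_mult_distrib mult.commute)
      finally show ?thesis using psd by (simp add: char_normal_law)
    qed
    then show ?thesis
      unfolding distr by (intro Levy_uniqueness real_distribution_normal_law \<Omega>.real_distribution_distr ext) auto
  qed
  then show ?thesis
    using law.prob_space_axioms by (intro exI[of _ P]) (auto simp: P_def)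
qed

text \<open>The Kolmogorov extension needs consistent marginals. The cosine integrals depend on
  \<open>K\<close> only through \<open>quad_form\<close>, and restriction from \<open>H\<close> to
  \<open>J\<close> amounts to padding \<open>u\<close> with zeros, which leaves the form
  unchanged.\<close>

lemma ex_gaussian_law:
  fixes K :: "'i \<Rightarrow> 'i \<Rightarrow> real"
  assumes sym: "\<And>i j. i \<in> I \<Longrightarrow> j \<in> I \<Longrightarrow> K i j = K j i"
    and psd: "\<And>J c. finite J \<Longrightarrow> J \<subseteq> I \<Longrightarrow> 0 \<le> quad_form K J c"
  obtains Q :: "('i \<Rightarrow> real) measure" where "prob_space Q" "sets Q = sets (Pi\<^sub>M I (\<lambda>_. borel))"
    and "\<And>J u. finite J \<Longrightarrow> J \<subseteq> I \<Longrightarrow>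
      distr Q borel (\<lambda>x. \<Sum>j\<in>J. u j * x j) = normal_law (quad_form K J u)"
proof -
  define is_law where "is_law J P \<longleftrightarrow> prob_space P \<and> sets P = sets (Pi\<^sub>M J (\<lambda>_. borel)) \<and>
    (\<forall>u. distr P borel (\<lambda>x. \<Sum>j\<in>J. u j * x j) = normal_law (quad_form K J u))"
    for J and P :: "('i \<Rightarrow> real) measure"
  \<comment> \<open>Any choice will do: \<open>K\<close> determines the cosine integrals and hence
    the law.\<close>
  define P where "P J = (SOME P. is_law J P)" for J
  have "is_law J (P J)" if "finite J" "J \<subseteq> I" for J
    unfolding P_def is_law_def
    by (rule someI_ex) (use that in \<open>intro ex_gaussian_law_finite psd sym; auto\<close>)
  then have law: "\<And>J. finite J \<Longrightarrow> J \<subseteq> I \<Longrightarrow> prob_space (P J)"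
    "\<And>J. finite J \<Longrightarrow> J \<subseteq> I \<Longrightarrow> sets (P J) = sets (Pi\<^sub>M J (\<lambda>_. borel))"
    "\<And>J u. finite J \<Longrightarrow> J \<subseteq> I \<Longrightarrow> distr (P J) borel (\<lambda>x. \<Sum>j\<in>J. u j * x j) = normal_law (quad_form K J u)"
    by (simp_all add: is_law_def)
  have lin_meas: "(\<lambda>x. \<Sum>j\<in>J. u j * x j) \<in> borel_measurable (Pi\<^sub>M J (\<lambda>_. borel))"
    for J and u :: "'i \<Rightarrow> real" by measurable
  have cos_P: "(LINT x|P J. cos ((\<Sum>j\<in>J. u j * x j) + v)) = cos v * exp (- quad_form K J u / 2)"
    if J: "finite J" "J \<subseteq> I" for J u v
  proof -
    have "(LINT x|P J. cos ((\<Sum>j\<in>J. u j * x j) + v)) = (LINT y|distr (P J) borel (\<lambda>x. \<Sum>j\<in>J. u j * x j). cos (y + v))"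
      by (subst integral_distr) (auto simp: measurable_cong_sets[OF law(2)[OF J] refl] lin_meas)
    then show ?thesis using J psd by (simp add: law(3) LINT_cos_normal_law)
  qed
  interpret polish_projective I P
  proof (intro polish_projective.intro projective_family.intro)
    show "prob_space (P J)" if "finite J" "J \<subseteq> I" for J using that by (rule law(1))
    fix J H assume JH: "J \<subseteq> H" "finite H" "H \<subseteq> I"
    then have J: "finite J" "J \<subseteq> I" using finite_subset by auto
    interpret PH: prob_space "P H" by (intro law JH)
    have R: "(\<lambda>f. restrict f J) \<in> measurable (P H) (Pi\<^sub>M J (\<lambda>_. borel))"
      using measurable_restrict_subset[OF JH(1)] measurable_cong_sets[OF law(2)[OF JH(2,3)] refl] by blast
    show "P J = distr (P H) (Pi\<^sub>M J (\<lambda>_. borel)) (\<lambda>f. restrict f J)"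
    proof (rule measure_eqI_trig[OF J(1) law(1,2)[OF J] PH.prob_space_distr[OF R]])
      fix u v
      have "(LINT x|distr (P H) (Pi\<^sub>M J (\<lambda>_. borel)) (\<lambda>f. restrict f J). cos ((\<Sum>j\<in>J. u j * x j) + v))
         = (LINT x|P H. cos ((\<Sum>j\<in>J. u j * x j) + v))"
        by (subst integral_distr[OF R]) auto
      also have "\<dots> = (LINT x|P H. cos ((\<Sum>j\<in>H. (if j \<in> J then u j else 0) * x j) + v))"
      proof -
        have "(\<Sum>j\<in>H. (if j \<in> J then u j else 0) * x j) = (\<Sum>j\<in>J. u j * x j)" for x :: "'i \<Rightarrow> real"
          using JH by (intro sum.mono_neutral_cong_right) auto
        then show ?thesis by simp
      qed
      also have "\<dots> = cos v * exp (- quad_form K J u / 2)"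
        using JH by (simp add: cos_P quad_form_extend)
      finally show "(LINT x|P J. cos ((\<Sum>j\<in>J. u j * x j) + v)) =
        (LINT x|distr (P H) (Pi\<^sub>M J (\<lambda>_. borel)) (\<lambda>f. restrict f J). cos ((\<Sum>j\<in>J. u j * x j) + v))"
        using J by (simp add: cos_P)
    qed simp
  qed
  show thesis
  proof
    show "prob_space lim" by (rule P.prob_space_axioms)
    show "sets lim = sets (Pi\<^sub>M I (\<lambda>_. borel))" by simp
    fix J u assume J: "finite J" "J \<subseteq> I"
    have R: "(\<lambda>f. restrict f J) \<in> measurable lim (Pi\<^sub>M J (\<lambda>_. borel))"
      using measurable_restrict_subset[OF J(2)] measurable_cong_sets[OF sets_lim refl] by blast
    have "P J = distr lim (Pi\<^sub>M J (\<lambda>_. borel)) (\<lambda>f. restrict f J)"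
    proof (rule measure_eqI)
      fix X assume "X \<in> sets (P J)"
      then have X: "X \<in> sets (Pi\<^sub>M J (\<lambda>_. borel))" using law(2)[OF J] by simp
      show "emeasure (P J) X = emeasure (distr lim (Pi\<^sub>M J (\<lambda>_. borel)) (\<lambda>f. restrict f J)) X"
        using emeasure_lim_emb[OF J(2,1) X] emeasure_distr[OF R X] by (simp add: prod_emb_def space_PiM)
    qed (simp add: law(2)[OF J])
    then have "distr (P J) borel (\<lambda>x. \<Sum>j\<in>J. u j * x j) = distr lim borel (\<lambda>x. \<Sum>j\<in>J. u j * x j)"
      using distr_distr[OF lin_meas[where J = J and u = u] R] by (simp add: comp_def)
    then show "distr lim borel (\<lambda>x. \<Sum>j\<in>J. u j * x j) = normal_law (quad_form K J u)"
      using law(3)[OF J] by simp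
  qed
qed

section \<open>Convergence of Gaussian vectors\<close>

lemma integrable_mult_of_square_integrable:
  fixes f g :: "'w \<Rightarrow> real"
  assumes [measurable]: "f \<in> borel_measurable M" "g \<in> borel_measurable M"
    and "integrable M (\<lambda>x. (f x)\<^sup>2)" "integrable M (\<lambda>x. (g x)\<^sup>2)"
  shows "integrable M (\<lambda>x. f x * g x)"
proof (rule Bochner_Integration.integrable_bound)
  show "integrable M (\<lambda>x. (f x)\<^sup>2 + (g x)\<^sup>2)" using assms by simp
  have "\<bar>u * v\<bar> \<le> u\<^sup>2 + v\<^sup>2" for u v :: real
  proof -
    have "2 * (\<bar>u\<bar> * \<bar>v\<bar>) \<le> u\<^sup>2 + v\<^sup>2"
      using sum_squares_bound[of "\<bar>u\<bar>" "\<bar>v\<bar>"] unfolding power2_abs by (simp only: mult.assoc)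
    moreover have "0 \<le> \<bar>u\<bar> * \<bar>v\<bar>" by simp
    ultimately show ?thesis unfolding abs_mult by linarith
  qed
  then show "AE x in M. norm (f x * g x) \<le> norm ((f x)\<^sup>2 + (g x)\<^sup>2)" by simp
qed measurable

lemma LINT_sum_mult_sum:
  fixes f :: "'i \<Rightarrow> 'w \<Rightarrow> real"
  assumes "\<And>i j. i \<in> I \<Longrightarrow> j \<in> J \<Longrightarrow> integrable M (\<lambda>\<omega>. f i \<omega> * g j \<omega>)"
  shows "(LINT \<omega>|M. (\<Sum>i\<in>I. f i \<omega>) * (\<Sum>j\<in>J. g j \<omega>)) = (\<Sum>i\<in>I. \<Sum>j\<in>J. LINT \<omega>|M. f i \<omega> * g j \<omega>)"
proof -
  have "(LINT \<omega>|M. (\<Sum>i\<in>I. f i \<omega>) * (\<Sum>j\<in>J. g j \<omega>)) = (LINT \<omega>|M. (\<Sum>i\<in>I. \<Sum>j\<in>J. f i \<omega> * g j \<omega>))"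
    by (simp only: sum_product)
  also have "\<dots> = (\<Sum>i\<in>I. LINT \<omega>|M. (\<Sum>j\<in>J. f i \<omega> * g j \<omega>))"
    by (intro Bochner_Integration.integral_sum Bochner_Integration.integrable_sum assms)
  also have "\<dots> = (\<Sum>i\<in>I. \<Sum>j\<in>J. LINT \<omega>|M. f i \<omega> * g j \<omega>)"
    by (intro sum.cong refl Bochner_Integration.integral_sum assms)
  finally show ?thesis .
qed

lemma LINT_lin_comb_squared:
  fixes Y :: "'i \<Rightarrow> 'w \<Rightarrow> real"
  assumes "\<And>i j. i \<in> J \<Longrightarrow> j \<in> J \<Longrightarrow> integrable M (\<lambda>\<omega>. Y i \<omega> * Y j \<omega>)"
  shows "(LINT \<omega>|M. (\<Sum>j\<in>J. u j * Y j \<omega>)\<^sup>2) = quad_form (\<lambda>i j. LINT \<omega>|M. Y i \<omega> * Y j \<omega>) J u"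
proof -
  have eq: "u i * Y i \<omega> * (u j * Y j \<omega>) = (u i * u j) * (Y i \<omega> * Y j \<omega>)" for i j \<omega>
    by (simp only: mult_ac)
  have "integrable M (\<lambda>\<omega>. u i * Y i \<omega> * (u j * Y j \<omega>))" if "i \<in> J" "j \<in> J" for i j
    unfolding eq using assms[OF that] by (rule integrable_mult_right)
  from LINT_sum_mult_sum[OF this]
  show ?thesis unfolding power2_eq_square quad_form_def eq integral_mult_right_zero .
qed

text \<open>Unit coefficient vectors recover the coordinates; their square integrability makes the
  products integrable.\<close>

lemma lin_combs_gaussian_imp_coordinates:
  fixes Y :: "'i \<Rightarrow> 'w \<Rightarrow> real"
  assumes "finite J" "\<And>u. centered_gaussian_rv M (\<lambda>\<omega>. \<Sum>j\<in>J. u j * Y j \<omega>)"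
  shows "i \<in> J \<Longrightarrow> centered_gaussian_rv M (Y i)"
    and "i \<in> J \<Longrightarrow> Y i \<in> borel_measurable M"
    and "i \<in> J \<Longrightarrow> j \<in> J \<Longrightarrow> integrable M (\<lambda>\<omega>. Y i \<omega> * Y j \<omega>)"
proof -
  have gauss: "centered_gaussian_rv M (Y i)" if "i \<in> J" for i
  proof -
    have "(\<Sum>j\<in>J. (if j = i then 1 else 0) * Y j \<omega>) = Y i \<omega>" for \<omega>
    proof -
      have "(\<Sum>j\<in>J. (if j = i then 1 else 0) * Y j \<omega>) = (\<Sum>j\<in>J. if j = i then Y j \<omega> else 0)"
        by (intro sum.cong) auto
      then show ?thesis using that assms(1) by simp
    qed
    then show ?thesis using assms(2)[of "\<lambda>j. if j = i then 1 else 0"] by simp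
  qed
  then show "i \<in> J \<Longrightarrow> centered_gaussian_rv M (Y i)" .
  have meas: "Y i \<in> borel_measurable M" if "i \<in> J" for i
    using gauss[OF that] by (simp add: centered_gaussian_rv_def)
  then show "i \<in> J \<Longrightarrow> Y i \<in> borel_measurable M" .
  show "i \<in> J \<Longrightarrow> j \<in> J \<Longrightarrow> integrable M (\<lambda>\<omega>. Y i \<omega> * Y j \<omega>)"
    by (intro integrable_mult_of_square_integrable meas centered_gaussian_rv_second_moment(1) gauss)
qed

text \<open>Outside the cube the sum of squares is at least \<open>L\<^sup>2\<close>, so Markov's
  inequality applies to it.\<close>

lemma measure_outside_cube_le:
  assumes J: "finite J" and M: "sets M = sets (Pi\<^sub>M J (\<lambda>_. borel))" "finite_measure M"
    and int: "\<And>j. j \<in> J \<Longrightarrow> integrable M (\<lambda>x. (x j)\<^sup>2)"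
    and le: "(\<Sum>j\<in>J. LINT x|M. (x j)\<^sup>2) \<le> B" and L: "0 < L"
  shows "measure M (outside_cube J L) \<le> B / L\<^sup>2"
proof -
  interpret finite_measure M by fact
  define T where "T x = (\<Sum>j\<in>J. (x j)\<^sup>2)" for x :: "'a \<Rightarrow> real"
  have sp: "space M = PiE J (\<lambda>_. UNIV)"
    using sets_eq_imp_space_eq[OF M(1)] by (simp add: space_PiM)
  have T_int: "integrable M T" unfolding T_def by (intro Bochner_Integration.integrable_sum int)
  have "L\<^sup>2 \<le> T x" if "x \<in> outside_cube J L" for x
  proof -
    obtain j where j: "j \<in> J" "L < \<bar>x j\<bar>" using \<open>x \<in> outside_cube J L\<close> by (auto simp: outside_cube_def)
    have "L\<^sup>2 \<le> (x j)\<^sup>2" using power_mono[of L "\<bar>x j\<bar>" 2] j(2) L by simp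
    also have "\<dots> \<le> T x" unfolding T_def using J j(1) by (intro member_le_sum) auto
    finally show ?thesis .
  qed
  then have "outside_cube J L \<subseteq> {x \<in> space M. L\<^sup>2 \<le> T x}"
    by (auto simp: sp outside_cube_def)
  moreover have "{x \<in> space M. L\<^sup>2 \<le> T x} \<in> sets M"
    using borel_measurable_integrable[OF T_int] by measurable
  ultimately have "measure M (outside_cube J L) \<le> measure M {x \<in> space M. L\<^sup>2 \<le> T x}"
    by (rule finite_measure_mono)
  also have "\<dots> \<le> (LINT x|M. T x) / L\<^sup>2"
  proof (rule integral_Markov_inequality_measure[OF T_int])
    show "AE x in M. 0 \<le> T x" by (simp add: T_def sum_nonneg)
  qed (use L in auto)
  also have "(LINT x|M. T x) = (\<Sum>j\<in>J. LINT x|M. (x j)\<^sup>2)"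
    unfolding T_def by (intro Bochner_Integration.integral_sum int)
  also have "\<dots> / L\<^sup>2 \<le> B / L\<^sup>2" using le by (rule divide_right_mono) simp
  finally show ?thesis .
qed

text \<open>The cosine integrals of a Gaussian vector are continuous functions of its covariances,
  and convergent variances are bounded, which gives tightness. Degenerate limits are
  covered.\<close>

theorem weakly_converges_gaussian:
  fixes Y :: "nat \<Rightarrow> 'i \<Rightarrow> 'w \<Rightarrow> real" and Z :: "'i \<Rightarrow> 'v \<Rightarrow> real"
  assumes J: "finite J" and P: "prob_space P" and Q: "prob_space Q"
    and Y: "\<And>N u. centered_gaussian_rv P (\<lambda>\<omega>. \<Sum>j\<in>J. u j * Y N j \<omega>)"
    and Z: "\<And>u. centered_gaussian_rv Q (\<lambda>\<omega>. \<Sum>j\<in>J. u j * Z j \<omega>)"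
    and conv: "\<And>i j. i \<in> J \<Longrightarrow> j \<in> J \<Longrightarrow>
      (\<lambda>N. LINT \<omega>|P. Y N i \<omega> * Y N j \<omega>) \<longlonglongrightarrow> (LINT \<omega>|Q. Z i \<omega> * Z j \<omega>)"
  shows "weakly_converges J (\<lambda>N. fin_dim_law P (Y N) J) (fin_dim_law Q Z J)"
proof -
  note Y' = lin_combs_gaussian_imp_coordinates[OF J Y]
  note Z' = lin_combs_gaussian_imp_coordinates[OF J Z]
  have measY: "(\<lambda>\<omega>. \<lambda>t\<in>J. Y N t \<omega>) \<in> measurable P (Pi\<^sub>M J (\<lambda>_. borel))" for N
    by (intro measurable_restrict Y'(2))
  have measZ: "(\<lambda>\<omega>. \<lambda>t\<in>J. Z t \<omega>) \<in> measurable Q (Pi\<^sub>M J (\<lambda>_. borel))"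
    by (intro measurable_restrict Z'(2))
  have cos_law: "(LINT x|fin_dim_law M W J. cos ((\<Sum>j\<in>J. u j * x j) + v)) =
      cos v * exp (- quad_form (\<lambda>i j. LINT \<omega>|M. W i \<omega> * W j \<omega>) J u / 2)"
    if W: "\<And>u. centered_gaussian_rv M (\<lambda>\<omega>. \<Sum>j\<in>J. u j * W j \<omega>)"
      and meas: "(\<lambda>\<omega>. \<lambda>t\<in>J. W t \<omega>) \<in> measurable M (Pi\<^sub>M J (\<lambda>_. borel))" for M :: "'c measure" and W u v
  proof -
    have "(LINT x|fin_dim_law M W J. cos ((\<Sum>j\<in>J. u j * x j) + v)) =
        (LINT \<omega>|M. cos ((\<Sum>j\<in>J. u j * (\<lambda>t\<in>J. W t \<omega>) j) + v))"
      unfolding fin_dim_law_def by (rule integral_distr[OF meas]) measurable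
    also have "\<dots> = (LINT \<omega>|M. cos ((\<Sum>j\<in>J. u j * W j \<omega>) + v))" by simp
    also have "\<dots> = cos v * exp (- (LINT \<omega>|M. (\<Sum>j\<in>J. u j * W j \<omega>)\<^sup>2) / 2)"
      by (rule centered_gaussian_rv_cos[OF W])
    also have "(LINT \<omega>|M. (\<Sum>j\<in>J. u j * W j \<omega>)\<^sup>2) = quad_form (\<lambda>i j. LINT \<omega>|M. W i \<omega> * W j \<omega>) J u"
      by (intro LINT_lin_comb_squared lin_combs_gaussian_imp_coordinates(3)[OF J W])
    finally show ?thesis .
  qed
  have square_law: "integrable (fin_dim_law M W J) (\<lambda>x. (x j)\<^sup>2)"
      "(LINT x|fin_dim_law M W J. (x j)\<^sup>2) = (LINT \<omega>|M. W j \<omega> * W j \<omega>)"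
    if W: "\<And>u. centered_gaussian_rv M (\<lambda>\<omega>. \<Sum>j\<in>J. u j * W j \<omega>)"
      and meas: "(\<lambda>\<omega>. \<lambda>t\<in>J. W t \<omega>) \<in> measurable M (Pi\<^sub>M J (\<lambda>_. borel))" and j: "j \<in> J"
    for M :: "'c measure" and W j
  proof -
    have sq: "(\<lambda>x. (x j)\<^sup>2) \<in> borel_measurable (Pi\<^sub>M J (\<lambda>_. borel :: real measure))"
      using j by measurable
    show "integrable (fin_dim_law M W J) (\<lambda>x. (x j)\<^sup>2)"
      unfolding fin_dim_law_def integrable_distr_eq[OF meas sq]
      using lin_combs_gaussian_imp_coordinates(3)[OF J W j j] j by (simp add: power2_eq_square)
    show "(LINT x|fin_dim_law M W J. (x j)\<^sup>2) = (LINT \<omega>|M. W j \<omega> * W j \<omega>)"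
      unfolding fin_dim_law_def integral_distr[OF meas sq] using j by (simp add: power2_eq_square)
  qed
  show ?thesis
  proof (rule weakly_converges_if_trig_tight[OF J])
    show prob: "prob_space (fin_dim_law P (Y N) J)" "prob_space (fin_dim_law Q Z J)" for N
      unfolding fin_dim_law_def
      by (rule prob_space.prob_space_distr[OF P measY], rule prob_space.prob_space_distr[OF Q measZ])
    show sets: "sets (fin_dim_law P (Y N) J) = sets (Pi\<^sub>M J (\<lambda>_. borel))"
      "sets (fin_dim_law Q Z J) = sets (Pi\<^sub>M J (\<lambda>_. borel))" for N
      by (simp_all add: fin_dim_law_def)
    show "(\<lambda>N. LINT x|fin_dim_law P (Y N) J. cos ((\<Sum>j\<in>J. u j * x j) + v)) \<longlonglongrightarrow>
        (LINT x|fin_dim_law Q Z J. cos ((\<Sum>j\<in>J. u j * x j) + v))" for u v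
      unfolding cos_law[OF Y measY] cos_law[OF Z measZ] quad_form_def
      by (intro tendsto_intros conv) auto
    fix e :: real assume e: "0 < e"
    have "(\<lambda>N. \<Sum>j\<in>J. LINT \<omega>|P. Y N j \<omega> * Y N j \<omega>) \<longlonglongrightarrow> (\<Sum>j\<in>J. LINT \<omega>|Q. Z j \<omega> * Z j \<omega>)"
      by (intro tendsto_sum conv)
    \<comment> \<open>Tightness is demanded for every \<open>N\<close>, so an eventual bound on the
      variances would not do.\<close>
    then have "Bseq (\<lambda>N. \<Sum>j\<in>J. LINT \<omega>|P. Y N j \<omega> * Y N j \<omega>)"
      using convergent_imp_Bseq convergentI by blast
    then obtain B1 where B1: "\<And>N. \<bar>\<Sum>j\<in>J. LINT \<omega>|P. Y N j \<omega> * Y N j \<omega>\<bar> \<le> B1"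
      by (auto simp: Bseq_def)
    define B where "B = max B1 \<bar>\<Sum>j\<in>J. LINT \<omega>|Q. Z j \<omega> * Z j \<omega>\<bar>"
    have BP: "(\<Sum>j\<in>J. LINT \<omega>|P. Y N j \<omega> * Y N j \<omega>) \<le> B" for N
      using B1[of N] by (simp add: B_def)
    have BQ: "(\<Sum>j\<in>J. LINT \<omega>|Q. Z j \<omega> * Z j \<omega>) \<le> B" and B0: "0 \<le> B"
      by (simp_all add: B_def)
    \<comment> \<open>Makes the bound \<open>B / L\<^sup>2\<close> at most \<open>e\<close>; the
      summand 1 keeps \<open>L\<close> positive when \<open>B = 0\<close>.\<close>
    define L where "L = sqrt ((B + 1) / e)"
    have L: "0 < L" using e B0 by (simp add: L_def)
    have "B / L\<^sup>2 = e * (B / (B + 1))" using e B0 by (simp add: L_def)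
    also have "\<dots> \<le> e" using e B0 by (intro mult_left_le) (auto simp: divide_le_eq)
    finally have BL: "B / L\<^sup>2 \<le> e" .
    show "\<exists>L>0. (\<forall>N. measure (fin_dim_law P (Y N) J) (outside_cube J L) \<le> e) \<and>
        measure (fin_dim_law Q Z J) (outside_cube J L) \<le> e"
    proof (intro exI[of _ L] conjI allI L)
      fix N
      have "measure (fin_dim_law P (Y N) J) (outside_cube J L) \<le> B / L\<^sup>2"
        using BP[of N] by (intro measure_outside_cube_le J sets(1) prob_space.finite_measure prob(1) L)
          (simp_all add: square_law[OF Y measY])
      with BL show "measure (fin_dim_law P (Y N) J) (outside_cube J L) \<le> e" by linarith
    next
      have "measure (fin_dim_law Q Z J) (outside_cube J L) \<le> B / L\<^sup>2"
        using BQ by (intro measure_outside_cube_le J sets(2) prob_space.finite_measure prob(2) L)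
          (simp_all add: square_law[OF Z measZ])
      with BL show "measure (fin_dim_law Q Z J) (outside_cube J L) \<le> e" by linarith
    qed
  qed
qed

text \<open>The coordinate process on path space. Its construction prescribes the variances of
  linear combinations; polarisation, with unit weights on \<open>{i}\<close> and on
  \<open>{i, j}\<close>, recovers the covariances.\<close>

corollary ex_centered_gaussian_field:
  fixes K :: "'i \<Rightarrow> 'i \<Rightarrow> real"
  assumes sym: "\<And>i j. i \<in> I \<Longrightarrow> j \<in> I \<Longrightarrow> K i j = K j i"
    and psd: "\<And>J c. finite J \<Longrightarrow> J \<subseteq> I \<Longrightarrow> 0 \<le> quad_form K J c"
  obtains Q :: "('i \<Rightarrow> real) measure" where "prob_space Q"
    and "centered_gaussian_field Q I (\<lambda>i \<omega>. \<omega> i)"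
    and "\<And>i j. i \<in> I \<Longrightarrow> j \<in> I \<Longrightarrow> (LINT \<omega>|Q. \<omega> i * \<omega> j) = K i j"
proof -
  obtain Q :: "('i \<Rightarrow> real) measure" where Q: "prob_space Q" "sets Q = sets (Pi\<^sub>M I (\<lambda>_. borel))"
    and law: "\<And>J u. finite J \<Longrightarrow> J \<subseteq> I \<Longrightarrow>
      distr Q borel (\<lambda>x. \<Sum>j\<in>J. u j * x j) = normal_law (quad_form K J u)"
    using ex_gaussian_law[OF sym psd] by blast
  have coord: "(\<lambda>x. x i) \<in> borel_measurable Q" if "i \<in> I" for i
    using measurable_component_singleton[OF that, of "\<lambda>_. borel"] measurable_cong_sets[OF Q(2) refl] by blast
  have gauss: "centered_gaussian_rv Q (\<lambda>x. \<Sum>j\<in>J. u j * x j)" if J: "finite J" "J \<subseteq> I" for J u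
    unfolding centered_gaussian_rv_iff_normal_law
  proof
    show "(\<lambda>x. \<Sum>j\<in>J. u j * x j) \<in> borel_measurable Q"
      using J by (intro borel_measurable_sum borel_measurable_times coord) auto
    show "\<exists>V\<ge>0. distr Q borel (\<lambda>x. \<Sum>j\<in>J. u j * x j) = normal_law V"
      using law[OF J] psd[OF J] by blast
  qed
  have quad: "quad_form (\<lambda>i j. LINT \<omega>|Q. \<omega> i * \<omega> j) J u = quad_form K J u" if J: "finite J" "J \<subseteq> I" for J u
  proof -
    have "quad_form (\<lambda>i j. LINT \<omega>|Q. \<omega> i * \<omega> j) J u = (LINT \<omega>|Q. (\<Sum>j\<in>J. u j * \<omega> j)\<^sup>2)"
      by (intro LINT_lin_comb_squared[symmetric] lin_combs_gaussian_imp_coordinates(3)[OF J(1) gauss[OF J]])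
    also have "\<dots> = (LINT x|distr Q borel (\<lambda>x. \<Sum>j\<in>J. u j * x j). x\<^sup>2)"
      using gauss[OF J] by (intro integral_distr[symmetric]) (auto simp: centered_gaussian_rv_def)
    also have "\<dots> = quad_form K J u"
      unfolding law[OF J] by (rule normal_law_second_moment(2)[OF psd[OF J]])
    finally show ?thesis .
  qed
  have diag: "(LINT \<omega>|Q. \<omega> i * \<omega> i) = K i i" if "i \<in> I" for i
    using quad[of "{i}" "\<lambda>_. 1"] that by (simp add: quad_form_def)
  have "(LINT \<omega>|Q. \<omega> i * \<omega> j) = K i j" if "i \<in> I" "j \<in> I" for i j
  proof (cases "i = j")
    case True
    then show ?thesis using diag that by simp
  next
    case False
    have "(LINT \<omega>|Q. \<omega> j * \<omega> i) = (LINT \<omega>|Q. \<omega> i * \<omega> j)" by (simp only: mult.commute)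
    then show ?thesis
      using quad[of "{i, j}" "\<lambda>_. 1"] that False diag sym[OF that] by (simp add: quad_form_def)
  qed
  then show thesis
    using Q(1) gauss by (intro that[of Q]) (auto simp: centered_gaussian_field_def)
qed

section \<open>Domination of the discretised covariance\<close>

text \<open>Trades an exponent that varies with \<open>h\<close> for a fixed one: on
  \<open>(0, 1]\<close> the smaller exponent gives the larger power, beyond 1 the power is at most
  1, and at 0 both powers are 0 by convention.\<close>

lemma powr_between_le:
  fixes x :: real
  assumes "0 \<le> x" "\<gamma> \<le> \<alpha>" "\<alpha> \<le> 0"
  shows "x powr \<alpha> \<le> x powr \<gamma> + 1"
proof -
  consider "x = 0" | "0 < x" "x \<le> 1" | "1 < x" using assms(1) by linarith
  then show ?thesis
  proof cases
    case 2
    then have "x powr \<alpha> \<le> x powr \<gamma>" using assms by (intro powr_mono') auto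
    then show ?thesis by simp
  next
    case 3
    then have "x powr \<alpha> \<le> x powr 0" using assms by (intro powr_mono) auto
    then show ?thesis using 3 by (simp add: add_increasing)
  qed simp
qed

lemma integrable_abs_powr:
  assumes "- 1 < \<gamma>"
  shows "integrable lborel (\<lambda>u::real. indicator {-T..T} u * \<bar>u\<bar> powr \<gamma>)"
proof (cases "0 \<le> T")
  case True
  have "(\<lambda>x. x powr \<gamma>) absolutely_integrable_on {0..T}"
    using has_integral_powr_from_0[OF assms True]
    by (intro nonnegative_absolutely_integrable_1) (auto simp: integrable_on_def)
  then have int: "integrable lborel (\<lambda>u. indicator {0..T} u * u powr \<gamma>)"
    unfolding set_integrable_def by (subst (asm) integrable_completion) auto
  then have "integrable lborel (\<lambda>u. indicator {0..T} (0 + (-1) * u) * (0 + (-1) * u) powr \<gamma>)"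
    by (rule lborel_integrable_real_affine) simp
  with int have "integrable lborel (\<lambda>u. indicator {0..T} u * u powr \<gamma> + indicator {0..T} (0 + (-1) * u) * (0 + (-1) * u) powr \<gamma>)"
    by (rule Bochner_Integration.integrable_add)
  \<comment> \<open>The two halves overlap only at 0, where \<open>0 powr \<gamma> = 0\<close>
    prevents double counting.\<close>
  also have "(\<lambda>u. indicator {0..T} u * u powr \<gamma> + indicator {0..T} (0 + (-1) * u) * (0 + (-1) * u) powr \<gamma>)
      = (\<lambda>u. indicator {-T..T} u * \<bar>u\<bar> powr \<gamma>)"
    by (auto simp: fun_eq_iff indicator_def)
  finally show ?thesis .
qed simp

text \<open>The substitution \<open>u = \<theta> - \<sigma>\<close> moves the singularity to 0. For
  \<open>\<theta>\<close> in \<open>[0, t]\<close> the range of \<open>u\<close> stays in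
  \<open>[-(t + s), t + s]\<close>, so the bound is uniform in \<open>\<theta>\<close>.\<close>

lemma integrable_shifted_powr:
  fixes \<theta> s :: real
  assumes "- 1 < \<gamma>"
  shows "integrable lborel (\<lambda>\<sigma>. indicator {0..s} \<sigma> * \<bar>\<theta> - \<sigma>\<bar> powr \<gamma>)"
    and "0 \<le> \<theta> \<Longrightarrow> \<theta> \<le> t \<Longrightarrow> 0 \<le> s \<Longrightarrow> (LINT \<sigma>|lborel. indicator {0..s} \<sigma> * \<bar>\<theta> - \<sigma>\<bar> powr \<gamma>)
      \<le> (LINT u|lborel. indicator {-(t + s)..t + s} u * \<bar>u\<bar> powr \<gamma>)"
proof -
  have shift: "integrable lborel (\<lambda>\<sigma>. indicator {-T..T} (\<theta> + (-1) * \<sigma>) * \<bar>\<theta> + (-1) * \<sigma>\<bar> powr \<gamma>)" for T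
    by (rule lborel_integrable_real_affine[OF integrable_abs_powr[OF assms]]) simp
  show int: "integrable lborel (\<lambda>\<sigma>. indicator {0..s} \<sigma> * \<bar>\<theta> - \<sigma>\<bar> powr \<gamma>)"
    by (rule Bochner_Integration.integrable_bound[OF shift[of "\<bar>\<theta>\<bar> + \<bar>s\<bar>"]]) (auto simp: indicator_def)
  assume "0 \<le> \<theta>" "\<theta> \<le> t" "0 \<le> s"
  then have "(LINT \<sigma>|lborel. indicator {0..s} \<sigma> * \<bar>\<theta> - \<sigma>\<bar> powr \<gamma>)
    \<le> (LINT \<sigma>|lborel. indicator {-(t + s)..t + s} (\<theta> + (-1) * \<sigma>) * \<bar>\<theta> + (-1) * \<sigma>\<bar> powr \<gamma>)"
    by (intro integral_mono[OF int shift]) (auto simp: indicator_def)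
  also have "\<dots> = (LINT u|lborel. indicator {-(t + s)..t + s} u * \<bar>u\<bar> powr \<gamma>)"
    using lborel_integral_real_affine[of "-1" "\<lambda>u. indicator {-(t + s)..t + s} u * \<bar>u\<bar> powr \<gamma>" \<theta>] by simp
  finally show "(LINT \<sigma>|lborel. indicator {0..s} \<sigma> * \<bar>\<theta> - \<sigma>\<bar> powr \<gamma>)
      \<le> (LINT u|lborel. indicator {-(t + s)..t + s} u * \<bar>u\<bar> powr \<gamma>)" .
qed

text \<open>Common majorant of the step functions and of the limit kernel, applied with
  \<open>\<gamma> = 2 * a - 2\<close>, which exceeds -1 because \<open>a > 1/2\<close>.\<close>

definition dominating :: "real \<Rightarrow> real \<Rightarrow> real \<Rightarrow> real \<Rightarrow> real \<times> real \<Rightarrow> real" where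
  "dominating C \<gamma> t s z =
     indicator ({0..t} \<times> {0..s}) z * (C * (\<bar>fst z - snd z\<bar> powr \<gamma> + 1))"

lemma dominating_measurable [measurable]:
  "dominating C \<gamma> t s \<in> borel_measurable (borel \<Otimes>\<^sub>M borel)"
  unfolding dominating_def[abs_def] by measurable

lemma integrable_dominating_slice:
  assumes "- 1 < \<gamma>"
  shows "integrable lborel (\<lambda>\<sigma>. dominating C \<gamma> t s (\<theta>, \<sigma>))"
proof -
  have "integrable lborel (\<lambda>\<sigma>. (indicator {0..t} \<theta> * C) * (indicator {0..s} \<sigma> * \<bar>\<theta> - \<sigma>\<bar> powr \<gamma> + indicator {0..s} \<sigma>))"
    using integrable_shifted_powr(1)[OF assms]
    by (intro integrable_mult_right Bochner_Integration.integrable_add)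
      (auto simp: integrable_indicator_iff emeasure_lborel_Icc_eq)
  then show ?thesis by (simp add: dominating_def indicator_times algebra_simps)
qed

text \<open>The inner integral is at most \<open>C * (W + s)\<close> uniformly in
  \<open>\<theta>\<close>, and \<open>\<theta>\<close> ranges over a bounded interval.\<close>

lemma integrable_dominating:
  assumes "- 1 < \<gamma>" "0 \<le> C" "0 \<le> t" "0 \<le> s"
  shows "integrable (lborel \<Otimes>\<^sub>M lborel) (dominating C \<gamma> t s)"
proof (rule lborel_pair.Fubini_integrable)
  define W where "W = (LINT u|lborel. indicator {-(t + s)..t + s} u * \<bar>u\<bar> powr \<gamma>)"
  show [measurable]: "dominating C \<gamma> t s \<in> borel_measurable (lborel \<Otimes>\<^sub>M lborel)"
    by measurable
  have nonneg: "0 \<le> dominating C \<gamma> t s z" for z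
    using assms(2) by (simp add: dominating_def)
  have "(LINT \<sigma>|lborel. dominating C \<gamma> t s (\<theta>, \<sigma>)) \<le> indicator {0..t} \<theta> * (C * (W + s))" for \<theta>
  proof (cases "\<theta> \<in> {0..t}")
    case True
    then have "(LINT \<sigma>|lborel. dominating C \<gamma> t s (\<theta>, \<sigma>)) =
        (LINT \<sigma>|lborel. C * (indicator {0..s} \<sigma> * \<bar>\<theta> - \<sigma>\<bar> powr \<gamma> + indicator {0..s} \<sigma>))"
      by (simp add: dominating_def indicator_times algebra_simps)
    also have "\<dots> = C * ((LINT \<sigma>|lborel. indicator {0..s} \<sigma> * \<bar>\<theta> - \<sigma>\<bar> powr \<gamma>) + s)"
      using integrable_shifted_powr(1)[OF assms(1), of s \<theta>] assms(4)
      by (subst integral_mult_right_zero, subst Bochner_Integration.integral_add)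
          (auto simp: integrable_indicator_iff emeasure_lborel_Icc_eq)
    also have "\<dots> \<le> C * (W + s)"
      using integrable_shifted_powr(2)[OF assms(1), of \<theta> t s] True assms
      by (intro mult_left_mono add_right_mono) (auto simp: W_def)
    finally show ?thesis using True by simp
  qed (simp add: dominating_def indicator_times)
  moreover have "0 \<le> (LINT \<sigma>|lborel. dominating C \<gamma> t s (\<theta>, \<sigma>))" for \<theta>
    by (intro Bochner_Integration.integral_nonneg nonneg)
  ultimately have bound: "norm (LINT \<sigma>|lborel. norm (dominating C \<gamma> t s (\<theta>, \<sigma>))) \<le> norm (indicator {0..t} \<theta> * (C * (W + s)))" for \<theta>
    using nonneg abs_ge_self order_trans by (simp add: order_trans[OF _ abs_ge_self])
  have "integrable lborel (\<lambda>\<theta>. indicator {0..t} \<theta> * (C * (W + s)))"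
    by (intro integrable_mult_left) (auto simp: integrable_indicator_iff emeasure_lborel_Icc_eq)
  then show "integrable lborel (\<lambda>\<theta>. LINT \<sigma>|lborel. norm (dominating C \<gamma> t s (\<theta>, \<sigma>)))"
    by (rule Bochner_Integration.integrable_bound) (use bound in auto)
  show "AE \<theta> in lborel. integrable lborel (\<lambda>\<sigma>. dominating C \<gamma> t s (\<theta>, \<sigma>))"
    using integrable_dominating_slice[OF assms(1)] by simp
qed

section \<open>Grid cells and the deterministic covariance setting\<close>

definition cell :: "nat \<Rightarrow> nat \<Rightarrow> real set" where
  "cell N n = {(real n - 1) / real N<..real n / real N}"

text \<open>Cells are open on the left and closed on the right so that membership is a condition on
  the ceiling; those with index from 1 to \<open>\<lfloor>N t\<rfloor>\<close> tile
  \<open>(0, \<lfloor>N t\<rfloor> / N]\<close>.\<close>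

lemma mem_cell_iff:
  assumes "1 \<le> N"
  shows "\<theta> \<in> cell N n \<longleftrightarrow> \<lceil>real N * \<theta>\<rceil> = int n"
  using assms by (simp add: cell_def ceiling_eq_iff field_simps)

lemma sum_indicator_cell:
  fixes f :: "nat \<Rightarrow> real"
  assumes "1 \<le> N"
  shows "(\<Sum>n = 1..nat K. f n * indicator (cell N n) \<theta>) =
    (if 1 \<le> \<lceil>real N * \<theta>\<rceil> \<and> \<lceil>real N * \<theta>\<rceil> \<le> K then f (nat \<lceil>real N * \<theta>\<rceil>) else 0)"
proof -
  let ?c = "\<lceil>real N * \<theta>\<rceil>"
  have "(\<Sum>n = 1..nat K. f n * indicator (cell N n) \<theta>) =
      (\<Sum>n = 1..nat K. if n = nat ?c then f (nat ?c) else 0)"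
  proof (intro sum.cong refl)
    fix n assume "n \<in> {1..nat K}"
    then have "\<lceil>real N * \<theta>\<rceil> = int n \<longleftrightarrow> n = nat ?c" by auto
    then show "f n * indicator (cell N n) \<theta> = (if n = nat ?c then f (nat ?c) else 0)"
      by (simp add: indicator_def mem_cell_iff[OF assms])
  qed
  also have "\<dots> = (if nat ?c \<in> {1..nat K} then f (nat ?c) else 0)"
    by (simp only: sum.delta finite_atLeastAtMost)
  also have "nat ?c \<in> {1..nat K} \<longleftrightarrow> 1 \<le> ?c \<and> ?c \<le> K"
    unfolding atLeastAtMost_iff by linarith
  finally show ?thesis .
qed

lemma LINT_cell_Times:
  assumes "1 \<le> N"
  shows "integrable (lborel \<Otimes>\<^sub>M lborel) (indicator (cell N n \<times> cell N m) :: real \<times> real \<Rightarrow> real)"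
    and "(LINT z|(lborel \<Otimes>\<^sub>M lborel). indicator (cell N n \<times> cell N m) z) = 1 / (real N)\<^sup>2"
proof -
  have cell: "emeasure lborel (cell N n) = ennreal (1 / real N)" for n
  proof -
    have "(real n - 1) / real N \<le> real n / real N" by (rule divide_right_mono) auto
    then show ?thesis unfolding cell_def by (simp add: diff_divide_distrib)
  qed
  have sets_cell: "cell N n \<in> sets lborel" for n by (simp add: cell_def)
  have em: "emeasure (lborel \<Otimes>\<^sub>M lborel) (cell N n \<times> cell N m) = ennreal (1 / (real N)\<^sup>2)"
    unfolding lborel.emeasure_pair_measure_Times[OF sets_cell sets_cell] cell
    by (subst ennreal_mult[symmetric]) (simp_all add: power2_eq_square)
  have sets: "cell N n \<times> cell N m \<in> sets (lborel \<Otimes>\<^sub>M lborel)"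
    by (rule pair_measureI[OF sets_cell sets_cell])
  show "integrable (lborel \<Otimes>\<^sub>M lborel) (indicator (cell N n \<times> cell N m) :: real \<times> real \<Rightarrow> real)"
    by (rule integrable_real_indicator[OF sets]) (simp add: em)
  have "(LINT z|(lborel \<Otimes>\<^sub>M lborel). indicator (cell N n \<times> cell N m) z) =
      measure (lborel \<Otimes>\<^sub>M lborel) (cell N n \<times> cell N m)"
    using sets.Int_space_eq2[OF sets] by (simp add: Int_commute)
  then show "(LINT z|(lborel \<Otimes>\<^sub>M lborel). indicator (cell N n \<times> cell N m) z) = 1 / (real N)\<^sup>2"
    by (simp add: measure_def em)
qed

text \<open>\<open>r j k H1 H2\<close> stands for the expectation of \<open>X j H1 * X k H2\<close>,
  which makes the limit of the covariances a purely analytic statement about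
  \<open>r\<close>.\<close>

locale long_range_covariance =
  fixes a b :: real
    and h :: "real \<Rightarrow> real"
    and R :: "real \<times> real \<Rightarrow> real"
    and r :: "nat \<Rightarrow> nat \<Rightarrow> real \<Rightarrow> real \<Rightarrow> real"
  assumes a: "1 / 2 < a" and ab: "a \<le> b" and b: "b < 1"
    and h_cont: "continuous_on UNIV h" and h_range: "\<And>x. h x \<in> {a..b}"
    and R_cont: "continuous_on ({a..b} \<times> {a..b}) R"
    and r_sym: "\<And>j k H1 H2. r j k H1 H2 = r k j H2 H1"
    and r_near: "\<And>M. 0 < M \<Longrightarrow> \<exists>B. \<forall>j\<ge>1. \<forall>k\<ge>1. \<bar>real j - real k\<bar> \<le> M \<longrightarrow>
      (\<forall>H1\<in>{a..b}. \<forall>H2\<in>{a..b}. \<bar>r j k H1 H2\<bar> \<le> B)"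
    and r_far: "\<And>\<eta>. 0 < \<eta> \<Longrightarrow> \<exists>M>0. \<forall>j\<ge>1. \<forall>k\<ge>1. real j - real k \<ge> M \<longrightarrow>
      (\<forall>H1\<in>{a..b}. \<forall>H2\<in>{a..b}.
        \<bar>(real j - real k) powr (2 - H1 - H2) * r j k H1 H2 - R (H1, H2)\<bar> \<le> \<eta>)"
begin

lemma h_bounds: "a \<le> h x" "h x \<le> b"
  using h_range[of x] by auto

lemma exponent_bounds: "2 * a - 2 \<le> h x + h y - 2" "h x + h y - 2 \<le> 0"
  using h_bounds[of x] h_bounds[of y] b by auto

lemma R_bounded: "\<exists>B\<ge>0. \<forall>z\<in>{a..b} \<times> {a..b}. \<bar>R z\<bar> \<le> B"
proof -
  have "bounded (R ` ({a..b} \<times> {a..b}))"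
    by (intro compact_imp_bounded compact_continuous_image R_cont compact_Times compact_Icc)
  then obtain B where B: "\<forall>z\<in>{a..b} \<times> {a..b}. \<bar>R z\<bar> \<le> B" by (auto simp: bounded_iff)
  show ?thesis by (intro exI[of _ "max B 0"]) (use B in \<open>auto intro: max.coboundedI1\<close>)
qed

text \<open>Large lags are governed by Assumption (ii) with \<open>\<eta> = 1\<close>, bounded lags
  by Assumption (i). The shift by 1 gives the bound a meaning at lag 0.\<close>

lemma r_bound:
  "\<exists>C\<ge>0. \<forall>j\<ge>1. \<forall>k\<ge>1. \<forall>H1\<in>{a..b}. \<forall>H2\<in>{a..b}.
     \<bar>r j k H1 H2\<bar> \<le> C * (1 + \<bar>real j - real k\<bar>) powr (H1 + H2 - 2)"
proof -
  from r_far[OF zero_less_one] obtain M0 where M0: "\<forall>j\<ge>1. \<forall>k\<ge>1. real j - real k \<ge> M0 \<longrightarrow>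
      (\<forall>H1\<in>{a..b}. \<forall>H2\<in>{a..b}. \<bar>(real j - real k) powr (2 - H1 - H2) * r j k H1 H2 - R (H1, H2)\<bar> \<le> 1)"
    by (elim exE conjE)
  \<comment> \<open>At lags \<open>d \<ge> 1\<close> one has \<open>1 + d \<le> 2 * d\<close>, so
    replacing \<open>d\<close> by \<open>1 + d\<close> in the power costs a factor
    \<open>2 powr (- al)\<close>, at most 4.\<close>
  define M where "M = max M0 1"
  obtain B where B: "B \<ge> 0" "\<And>z. z \<in> {a..b} \<times> {a..b} \<Longrightarrow> \<bar>R z\<bar> \<le> B" using R_bounded by auto
  have "0 < M" by (simp add: M_def)
  from r_near[OF this] obtain D where D: "\<forall>j\<ge>1. \<forall>k\<ge>1. \<bar>real j - real k\<bar> \<le> M \<longrightarrow>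
      (\<forall>H1\<in>{a..b}. \<forall>H2\<in>{a..b}. \<bar>r j k H1 H2\<bar> \<le> D)"
    by (elim exE)
  have far: "\<bar>r j k H1 H2\<bar> \<le> 4 * (B + 1) * (1 + \<bar>real j - real k\<bar>) powr (H1 + H2 - 2)"
    if jk: "1 \<le> j" "1 \<le> k" "real j - real k \<ge> M" and H: "H1 \<in> {a..b}" "H2 \<in> {a..b}" for j k H1 H2
  proof -
    define d where "d = real j - real k"
    define al where "al = H1 + H2 - 2"
    have al: "- 2 \<le> al" "al \<le> 0" using H a b by (auto simp: al_def)
    have d: "1 \<le> d" "M0 \<le> d" using jk by (auto simp: d_def M_def)
    have "\<bar>d powr (- al) * r j k H1 H2 - R (H1, H2)\<bar> \<le> 1"
      using M0[rule_format, OF jk(1,2) _ H] d(2) by (simp add: d_def al_def algebra_simps)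
    moreover have "\<bar>R (H1, H2)\<bar> \<le> B" using B H by auto
    ultimately have "\<bar>d powr (- al) * r j k H1 H2\<bar> \<le> B + 1" by linarith
    then have "d powr (- al) * \<bar>r j k H1 H2\<bar> \<le> B + 1" by (simp add: abs_mult)
    then have "\<bar>r j k H1 H2\<bar> \<le> (B + 1) * d powr al"
      using d(1) by (simp add: powr_minus field_simps)
    also have "d powr al \<le> ((1 + d) / 2) powr al"
      using d(1) al by (intro powr_mono2') auto
    also have "((1 + d) / 2) powr al = 2 powr (- al) * (1 + d) powr al"
      using d(1) by (simp add: powr_divide powr_minus field_simps)
    also have "2 powr (- al) \<le> (2::real) powr 2"
      using al by (intro powr_mono) auto
    finally show ?thesis using B(1) d(1) by (simp add: d_def al_def mult_left_mono mult_right_mono) (simp add: algebra_simps)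
  qed
  have near: "\<bar>r j k H1 H2\<bar> \<le> \<bar>D\<bar> * (1 + M) * (1 + \<bar>real j - real k\<bar>) powr (H1 + H2 - 2)"
    if jk: "1 \<le> j" "1 \<le> k" "\<bar>real j - real k\<bar> \<le> M" and H: "H1 \<in> {a..b}" "H2 \<in> {a..b}" for j k H1 H2
  proof -
    define d where "d = \<bar>real j - real k\<bar>"
    have d: "0 \<le> d" "d \<le> M" using jk by (auto simp: d_def)
    \<comment> \<open>As \<open>H1 + H2 - 2 \<ge> 2 * a - 2 > -1\<close>, the power is at least
      \<open>1 / (1 + M)\<close> at lags up to \<open>M\<close>, which absorbs the constant bound
      \<open>D\<close>.\<close>
    have "1 = (1 + d) * (1 + d) powr (- 1)" using d by (simp add: powr_minus)
    also have "\<dots> \<le> (1 + M) * (1 + d) powr (H1 + H2 - 2)"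
      using d H a by (intro mult_mono powr_mono) auto
    finally have "\<bar>D\<bar> * 1 \<le> \<bar>D\<bar> * ((1 + M) * (1 + d) powr (H1 + H2 - 2))"
      by (intro mult_left_mono) auto
    then show ?thesis using D[rule_format, OF jk H] by (simp add: d_def mult.assoc)
  qed
  define C where "C = max (4 * (B + 1)) (\<bar>D\<bar> * (1 + M))"
  have C: "0 \<le> C" "4 * (B + 1) \<le> C" "\<bar>D\<bar> * (1 + M) \<le> C" using B(1) by (auto simp: C_def)
  have "\<bar>r j k H1 H2\<bar> \<le> C * (1 + \<bar>real j - real k\<bar>) powr (H1 + H2 - 2)"
    if jk: "1 \<le> j" "1 \<le> k" and H: "H1 \<in> {a..b}" "H2 \<in> {a..b}" for j k H1 H2
  proof -
    consider "\<bar>real j - real k\<bar> \<le> M" | "real j - real k \<ge> M" | "real k - real j \<ge> M" by linarith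
    then show ?thesis
    proof cases
      case 1
      show ?thesis
        by (rule order_trans[OF near[OF jk 1 H]]) (intro mult_right_mono C; simp)
    next
      case 2
      show ?thesis
        by (rule order_trans[OF far[OF jk 2 H]]) (intro mult_right_mono C; simp)
    next
      case 3
      \<comment> \<open>The far estimate is one-sided; \<open>r_sym\<close> exchanges indices and
        parameters together, which leaves the bound unchanged.\<close>
      have "\<bar>r k j H2 H1\<bar> \<le> C * (1 + \<bar>real k - real j\<bar>) powr (H2 + H1 - 2)"
        by (rule order_trans[OF far[OF jk(2,1) 3 H(2,1)]]) (intro mult_right_mono C; simp)
      then show ?thesis using r_sym[of j k H1 H2] by (simp add: abs_minus_commute add.commute)
    qed
  qed
  then show ?thesis using C(1) by blast
qed

definition cov :: "nat \<Rightarrow> nat \<Rightarrow> nat \<Rightarrow> real" where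
  "cov N n m = r n m (h (real n / real N)) (h (real m / real N)) /
     real N powr (h (real n / real N) + h (real m / real N))"

lemma cov_sym: "cov N n m = cov N m n"
  using r_sym[of n m] by (simp add: cov_def add.commute)

definition step :: "nat \<Rightarrow> real \<Rightarrow> real \<Rightarrow> real \<times> real \<Rightarrow> real" where
  "step N t s z = (\<Sum>n = 1..nat \<lfloor>real N * t\<rfloor>. \<Sum>m = 1..nat \<lfloor>real N * s\<rfloor>.
     (real N)\<^sup>2 * cov N n m * indicator (cell N n \<times> cell N m) z)"

lemma step_eq:
  assumes "1 \<le> N"
  shows "step N t s (\<theta>, \<sigma>) =
    (if 1 \<le> \<lceil>real N * \<theta>\<rceil> \<and> \<lceil>real N * \<theta>\<rceil> \<le> \<lfloor>real N * t\<rfloor> \<and>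
        1 \<le> \<lceil>real N * \<sigma>\<rceil> \<and> \<lceil>real N * \<sigma>\<rceil> \<le> \<lfloor>real N * s\<rfloor>
     then (real N)\<^sup>2 * cov N (nat \<lceil>real N * \<theta>\<rceil>) (nat \<lceil>real N * \<sigma>\<rceil>) else 0)"
proof -
  have "step N t s (\<theta>, \<sigma>) = (\<Sum>n = 1..nat \<lfloor>real N * t\<rfloor>.
      (\<Sum>m = 1..nat \<lfloor>real N * s\<rfloor>. (real N)\<^sup>2 * cov N n m * indicator (cell N m) \<sigma>) * indicator (cell N n) \<theta>)"
    unfolding step_def sum_distrib_right
    by (intro sum.cong refl) (simp only: indicator_times fst_conv snd_conv mult_ac)
  then show ?thesis
    by (simp only: sum_indicator_cell[OF assms]) auto
qed

lemma LINT_step: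
  assumes "1 \<le> N"
  shows "(LINT z|(lborel \<Otimes>\<^sub>M lborel). step N t s z) =
    (\<Sum>n = 1..nat \<lfloor>real N * t\<rfloor>. \<Sum>m = 1..nat \<lfloor>real N * s\<rfloor>. cov N n m)"
proof -
  have int: "integrable (lborel \<Otimes>\<^sub>M lborel) (\<lambda>z. (real N)\<^sup>2 * cov N n m * indicator (cell N n \<times> cell N m) z)" for n m
    by (intro integrable_mult_right LINT_cell_Times(1)[OF assms])
  have one: "(LINT z|(lborel \<Otimes>\<^sub>M lborel). (real N)\<^sup>2 * cov N n m * indicator (cell N n \<times> cell N m) z) = cov N n m" for n m
    unfolding integral_mult_right_zero LINT_cell_Times(2)[OF assms] using assms by simp
  have "(LINT z|(lborel \<Otimes>\<^sub>M lborel). step N t s z) = (\<Sum>n = 1..nat \<lfloor>real N * t\<rfloor>. \<Sum>m = 1..nat \<lfloor>real N * s\<rfloor>.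
      (LINT z|(lborel \<Otimes>\<^sub>M lborel). (real N)\<^sup>2 * cov N n m * indicator (cell N n \<times> cell N m) z))"
    unfolding step_def
    by (subst Bochner_Integration.integral_sum, intro Bochner_Integration.integrable_sum int)
      (intro sum.cong refl Bochner_Integration.integral_sum int)
  then show ?thesis unfolding one .
qed

text \<open>The diagonal must be left out: there \<open>0 powr (2 * a - 2) = 0\<close> reduces the
  majorant to \<open>C\<close>, while \<open>step\<close> can grow like
  \<open>N powr (2 - 2 * h)\<close>.\<close>

lemma step_bound:
  "\<exists>C\<ge>0. \<forall>N\<ge>1. \<forall>t s z. fst z \<noteq> snd z \<longrightarrow> \<bar>step N t s z\<bar> \<le> dominating C (2 * a - 2) t s z"
proof -
  from r_bound obtain C where C0: "0 \<le> C" and C: "\<forall>j\<ge>1. \<forall>k\<ge>1. \<forall>H1\<in>{a..b}. \<forall>H2\<in>{a..b}.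
     \<bar>r j k H1 H2\<bar> \<le> C * (1 + \<bar>real j - real k\<bar>) powr (H1 + H2 - 2)"
    by (elim exE conjE)
  have "\<bar>step N t s (\<theta>, \<sigma>)\<bar> \<le> dominating C (2 * a - 2) t s (\<theta>, \<sigma>)"
    if N: "1 \<le> N" and ne: "\<theta> \<noteq> \<sigma>" for N t s \<theta> \<sigma>
  proof (cases "1 \<le> \<lceil>real N * \<theta>\<rceil> \<and> \<lceil>real N * \<theta>\<rceil> \<le> \<lfloor>real N * t\<rfloor> \<and>
        1 \<le> \<lceil>real N * \<sigma>\<rceil> \<and> \<lceil>real N * \<sigma>\<rceil> \<le> \<lfloor>real N * s\<rfloor>")
    case True
    have N0: "0 < real N" using N by simp
    define p q where "p = nat \<lceil>real N * \<theta>\<rceil>" and "q = nat \<lceil>real N * \<sigma>\<rceil>"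
    have p: "1 \<le> p" "real p = of_int \<lceil>real N * \<theta>\<rceil>" and q: "1 \<le> q" "real q = of_int \<lceil>real N * \<sigma>\<rceil>"
      using True by (auto simp: p_def q_def le_nat_iff)
    have pr: "real p - 1 < real N * \<theta>" "real N * \<theta> \<le> real p" and qr: "real q - 1 < real N * \<sigma>" "real N * \<sigma> \<le> real q"
      unfolding p(2) q(2) by linarith+
    have le: "real p \<le> real N * t" "real q \<le> real N * s"
      using True unfolding p(2) q(2) by linarith+
    have "0 < real N * \<theta>" "0 < real N * \<sigma>" using pr qr p q by linarith+
    moreover have "real N * \<theta> \<le> real N * t" "real N * \<sigma> \<le> real N * s" using pr qr le by linarith+
    ultimately have mem: "\<theta> \<in> {0..t}" "\<sigma> \<in> {0..s}"
      using N0 by (auto simp: zero_less_mult_iff)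
    define H1 H2 where "H1 = h (real p / real N)" and "H2 = h (real q / real N)"
    define al where "al = H1 + H2 - 2"
    have al: "2 * a - 2 \<le> al" "al \<le> 0" using exponent_bounds by (auto simp: al_def H1_def H2_def)
    have "step N t s (\<theta>, \<sigma>) = (real N)\<^sup>2 * (r p q H1 H2 / real N powr (H1 + H2))"
      using True by (simp add: step_eq[OF N] cov_def p_def q_def H1_def H2_def)
    \<comment> \<open>The factor \<open>N\<^sup>2\<close> against the normalisation
      \<open>N powr (H1 + H2)\<close> leaves exactly the power that rescales the lag by
      \<open>1 / N\<close> below.\<close>
    also have "\<dots> = real N powr (- al) * r p q H1 H2"
    proof -
      have "- al = 2 - (H1 + H2)" by (simp add: al_def)
      then have "real N powr (- al) = (real N)\<^sup>2 / real N powr (H1 + H2)"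
        using N0 by (simp only: powr_diff powr_numeral)
      then show ?thesis by simp
    qed
    finally have e1: "\<bar>step N t s (\<theta>, \<sigma>)\<bar> = real N powr (- al) * \<bar>r p q H1 H2\<bar>" by (simp add: abs_mult)
    have "\<bar>r p q H1 H2\<bar> \<le> C * (1 + \<bar>real p - real q\<bar>) powr al"
      using C[rule_format, OF p(1) q(1) h_range h_range] by (simp add: al_def H1_def H2_def)
    then have e2: "real N powr (- al) * \<bar>r p q H1 H2\<bar> \<le> real N powr (- al) * (C * (1 + \<bar>real p - real q\<bar>) powr al)"
      by (rule mult_left_mono) simp
    have e3: "real N powr (- al) * (C * (1 + \<bar>real p - real q\<bar>) powr al) = C * ((1 + \<bar>real p - real q\<bar>) / real N) powr al"
      using N0 by (simp add: powr_divide powr_minus_divide)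
    have e4: "((1 + \<bar>real p - real q\<bar>) / real N) powr al \<le> \<bar>\<theta> - \<sigma>\<bar> powr al"
    proof (rule powr_mono2'[OF al(2)])
      \<comment> \<open>Rounding up moves each of the two numbers by less than 1 in the same
        direction, so their difference changes by less than 1.\<close>
      have "\<bar>real N * \<theta> - real N * \<sigma>\<bar> \<le> 1 + \<bar>real p - real q\<bar>" using pr qr by linarith
      also have "real N * \<theta> - real N * \<sigma> = (\<theta> - \<sigma>) * real N" by (simp add: left_diff_distrib)
      finally have "\<bar>\<theta> - \<sigma>\<bar> * real N \<le> 1 + \<bar>real p - real q\<bar>" by (simp only: abs_mult abs_of_nat)
      then show "\<bar>\<theta> - \<sigma>\<bar> \<le> (1 + \<bar>real p - real q\<bar>) / real N"
        by (rule mult_imp_le_div_pos[OF N0])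
      show "0 < \<bar>\<theta> - \<sigma>\<bar>" using ne by simp
    qed
    have e5: "\<bar>\<theta> - \<sigma>\<bar> powr al \<le> \<bar>\<theta> - \<sigma>\<bar> powr (2 * a - 2) + 1"
      using al by (intro powr_between_le) simp_all
    have "\<bar>step N t s (\<theta>, \<sigma>)\<bar> \<le> C * (\<bar>\<theta> - \<sigma>\<bar> powr (2 * a - 2) + 1)"
      using mult_left_mono[OF order_trans[OF e4 e5] C0] e2 unfolding e1 e3 by (rule order_trans[rotated])
    then show ?thesis using mem by (simp add: dominating_def)
  next
    case False
    then have "step N t s (\<theta>, \<sigma>) = 0" unfolding step_eq[OF N] by (rule if_not_P)
    then show ?thesis using C0 by (simp add: dominating_def)
  qed
  note bound = this
  show ?thesis
  proof (intro exI[of _ C] conjI allI impI)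
    fix N :: nat and t s and z :: "real \<times> real"
    assume N: "1 \<le> N" and z: "fst z \<noteq> snd z"
    show "\<bar>step N t s z\<bar> \<le> dominating C (2 * a - 2) t s z"
      using bound[OF N z] by (simp only: prod.collapse)
  qed (rule C0)
qed

end

section \<open>Convergence of the covariances\<close>

lemma ceiling_index_tendsto:
  fixes \<theta> :: real
  assumes "0 \<le> \<theta>"
  shows "(\<lambda>N. real (nat \<lceil>real N * \<theta>\<rceil>) / real N) \<longlonglongrightarrow> \<theta>"
proof (rule tendsto_sandwich)
  have "\<theta> \<le> real (nat \<lceil>real N * \<theta>\<rceil>) / real N \<and>
      real (nat \<lceil>real N * \<theta>\<rceil>) / real N \<le> \<theta> + 1 / real N" if "1 \<le> N" for N
  proof -
    have "0 \<le> real N * \<theta>" using assms by simp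
    then have "real N * \<theta> \<le> real (nat \<lceil>real N * \<theta>\<rceil>)" "real (nat \<lceil>real N * \<theta>\<rceil>) \<le> real N * \<theta> + 1"
      by linarith+
    then show ?thesis using that by (simp add: field_simps)
  qed
  then show "\<forall>\<^sub>F N in sequentially. \<theta> \<le> real (nat \<lceil>real N * \<theta>\<rceil>) / real N"
    "\<forall>\<^sub>F N in sequentially. real (nat \<lceil>real N * \<theta>\<rceil>) / real N \<le> \<theta> + 1 / real N"
    by (auto simp: eventually_sequentially)
  show "(\<lambda>N. \<theta> + 1 / real N) \<longlonglongrightarrow> \<theta>"
    using tendsto_add[OF tendsto_const lim_1_over_n, of \<theta>] by simp
qed simp

context long_range_covariance
begin

text \<open>For large \<open>N\<close> the left side factors as \<open>B N * A N\<close>: the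
  covariance normalised as in Assumption (ii), and a power of the rescaled lag. Uniformity in the
  parameters allows comparing \<open>B N\<close> with \<open>R (H1 N, H2 N)\<close> although the
  arguments move.\<close>

lemma cov_tendsto:
  assumes "0 < \<sigma>" "\<sigma> < \<theta>"
  shows "(\<lambda>N. (real N)\<^sup>2 * cov N (nat \<lceil>real N * \<theta>\<rceil>) (nat \<lceil>real N * \<sigma>\<rceil>)) \<longlonglongrightarrow> limit_kernel R h \<theta> \<sigma>"
proof -
  define p q where "p N = nat \<lceil>real N * \<theta>\<rceil>" and "q N = nat \<lceil>real N * \<sigma>\<rceil>" for N
  define H1 H2 where "H1 N = h (real (p N) / real N)" and "H2 N = h (real (q N) / real N)" for N
  define A where "A N = (real (p N) / real N - real (q N) / real N) powr (H1 N + H2 N - 2)" for N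
  define D where "D N = real (p N) - real (q N)" for N
  define B where "B N = D N powr (2 - H1 N - H2 N) * r (p N) (q N) (H1 N) (H2 N)" for N
  have H: "H1 N \<in> {a..b}" "H2 N \<in> {a..b}" for N
    using h_range by (auto simp: H1_def H2_def)
  have pN: "(\<lambda>N. real (p N) / real N) \<longlonglongrightarrow> \<theta>" and qN: "(\<lambda>N. real (q N) / real N) \<longlonglongrightarrow> \<sigma>"
    unfolding p_def q_def by (rule ceiling_index_tendsto; use assms in simp)+
  have h_lim: "(\<lambda>N. h (x N)) \<longlonglongrightarrow> h y" if "x \<longlonglongrightarrow> y" for x :: "nat \<Rightarrow> real" and y
    using continuous_on_tendsto_compose[OF h_cont that] by simp
  have H1_lim: "H1 \<longlonglongrightarrow> h \<theta>" and H2_lim: "H2 \<longlonglongrightarrow> h \<sigma>"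
    unfolding H1_def H2_def by (intro h_lim pN qN)+
  have A_lim: "A \<longlonglongrightarrow> (\<theta> - \<sigma>) powr (h \<theta> + h \<sigma> - 2)"
    unfolding A_def by (intro tendsto_intros pN qN H1_lim H2_lim) (use assms in auto)
  have "(\<lambda>N. R (H1 N, H2 N)) \<longlonglongrightarrow> R (h \<theta>, h \<sigma>)"
    using H h_range by (intro continuous_on_tendsto_compose[OF R_cont] tendsto_Pair H1_lim H2_lim) auto
  moreover have "(\<lambda>N. B N - R (H1 N, H2 N)) \<longlonglongrightarrow> 0"
  proof (rule LIMSEQ_I)
    fix e :: real assume e: "0 < e"
    then have "0 < e / 2" by simp
    from r_far[OF this] obtain M where M: "\<forall>j\<ge>1. \<forall>k\<ge>1. real j - real k \<ge> M \<longrightarrow>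
      (\<forall>H1\<in>{a..b}. \<forall>H2\<in>{a..b}. \<bar>(real j - real k) powr (2 - H1 - H2) * r j k H1 H2 - R (H1, H2)\<bar> \<le> e / 2)"
      by (elim exE conjE)
    \<comment> \<open>The rounded lag exceeds \<open>N * (\<theta> - \<sigma>) - 1\<close>, so the
      threshold \<open>M + 1\<close> pushes it past \<open>M\<close>.\<close>
    obtain n0 :: nat where n0: "(M + 1) / (\<theta> - \<sigma>) \<le> real n0" using real_arch_simple by blast
    have "norm (B N - R (H1 N, H2 N) - 0) < e" if N: "N \<ge> max 1 n0" for N
    proof -
      have "(M + 1) / (\<theta> - \<sigma>) \<le> real N" using n0 N by linarith
      then have *: "M + 1 \<le> real N * \<theta> - real N * \<sigma>" using assms by (simp add: field_simps)
      have pos: "0 < real N * \<theta>" "0 < real N * \<sigma>" using N assms by auto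
      have "1 \<le> p N" "1 \<le> q N" "real (p N) - real (q N) \<ge> M"
        using pos * unfolding p_def q_def by linarith+
      from M[rule_format, OF this H(1)[of N] H(2)[of N]]
      show ?thesis using e by (simp add: B_def D_def)
    qed
    then show "\<exists>n0. \<forall>N\<ge>n0. norm (B N - R (H1 N, H2 N) - 0) < e" by blast
  qed
  ultimately have "(\<lambda>N. (B N - R (H1 N, H2 N)) + R (H1 N, H2 N)) \<longlonglongrightarrow> 0 + R (h \<theta>, h \<sigma>)"
    by (intro tendsto_add)
  then have B_lim: "B \<longlonglongrightarrow> R (h \<theta>, h \<sigma>)" by simp
  \<comment> \<open>From this index on the lag is positive, as cancelling its powers
    requires.\<close>
  obtain n1 :: nat where n1: "1 / (\<theta> - \<sigma>) \<le> real n1" using real_arch_simple by blast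
  have "(real N)\<^sup>2 * cov N (p N) (q N) = B N * A N" if N: "N \<ge> max 1 n1" for N
  proof -
    have N0: "0 < real N" using N by simp
    have "1 / (\<theta> - \<sigma>) \<le> real N" using n1 N by linarith
    then have *: "1 \<le> real N * \<theta> - real N * \<sigma>" using assms by (simp add: field_simps)
    have pos: "0 < real N * \<theta>" "0 < real N * \<sigma>" using N assms by auto
    have D0: "0 < D N" using * pos unfolding D_def p_def q_def by linarith
    define al where "al = H1 N + H2 N - 2"
    have "A N = (D N / real N) powr al" by (simp add: A_def D_def al_def diff_divide_distrib)
    also have "\<dots> = D N powr al / real N powr al" using D0 N0 by (simp add: powr_divide)
    finally have "B N * A N = (D N powr (- al) * D N powr al) * r (p N) (q N) (H1 N) (H2 N) / real N powr al"
      by (simp add: B_def al_def algebra_simps)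
    also have "D N powr (- al) * D N powr al = 1" using D0 by (simp add: powr_add[symmetric])
    also have "1 * r (p N) (q N) (H1 N) (H2 N) / real N powr al = (real N)\<^sup>2 * cov N (p N) (q N)"
      using N0 by (simp add: cov_def H1_def H2_def al_def powr_diff powr_numeral)
    finally show ?thesis by simp
  qed
  then have "\<forall>\<^sub>F N in sequentially. B N * A N = (real N)\<^sup>2 * cov N (p N) (q N)"
    unfolding eventually_sequentially by (intro exI[of _ "max 1 n1"]) simp
  from Lim_transform_eventually[OF tendsto_mult[OF B_lim A_lim] this]
  show ?thesis using assms by (simp add: limit_kernel_def calR_def p_def q_def)
qed

text \<open>The exchange of the arguments of \<open>R\<close> in \<open>calR\<close> compensates the
  exchange of \<open>\<theta>\<close> and \<open>\<sigma>\<close>; this reduces the half plane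
  \<open>\<theta> < \<sigma>\<close> to the other one.\<close>

lemma limit_kernel_sym: "limit_kernel R h \<theta> \<sigma> = limit_kernel R h \<sigma> \<theta>"
  by (cases "\<theta> = \<sigma>") (auto simp: limit_kernel_def calR_def abs_minus_commute add.commute)

text \<open>Convergence can fail on the excluded lines: at \<open>\<theta> = t\<close> the step
  function vanishes whenever \<open>N t\<close> is not an integer, since then
  \<open>\<lceil>N t\<rceil> > \<lfloor>N t\<rfloor>\<close>. These lines are null sets.\<close>

lemma step_tendsto:
  assumes "\<theta> \<noteq> \<sigma>" "\<theta> \<notin> {0, t}" "\<sigma> \<notin> {0, s}"
  shows "(\<lambda>N. step N t s (\<theta>, \<sigma>)) \<longlonglongrightarrow>
    indicator ({0..t} \<times> {0..s}) (\<theta>, \<sigma>) * limit_kernel R h \<theta> \<sigma>"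
proof (cases "(\<theta>, \<sigma>) \<in> {0..t} \<times> {0..s}")
  case False
  \<comment> \<open>Vanishing off the rectangle is read off from the majorant, which is 0
    there.\<close>
  obtain C where C: "\<forall>N\<ge>1. \<forall>t s z. fst z \<noteq> snd z \<longrightarrow> \<bar>step N t s z\<bar> \<le> dominating C (2 * a - 2) t s z"
    using step_bound by auto
  have "step N t s (\<theta>, \<sigma>) = 0" if "1 \<le> N" for N
    using C[rule_format, OF that, of "(\<theta>, \<sigma>)" t s] False assms(1) by (simp add: dominating_def)
  then have "\<forall>\<^sub>F N in sequentially. step N t s (\<theta>, \<sigma>) = 0"
    unfolding eventually_sequentially by (intro exI[of _ 1]) simp
  then show ?thesis using False by (simp add: tendsto_eventually)
next
  case True
  then have pos: "0 < \<theta>" "\<theta> < t" "0 < \<sigma>" "\<sigma> < s" using assms by auto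
  have lim: "(\<lambda>N. (real N)\<^sup>2 * cov N (nat \<lceil>real N * \<theta>\<rceil>) (nat \<lceil>real N * \<sigma>\<rceil>)) \<longlonglongrightarrow> limit_kernel R h \<theta> \<sigma>"
  proof (cases "\<sigma> < \<theta>")
    case True
    then show ?thesis using cov_tendsto pos by simp
  next
    case False
    then have "\<theta> < \<sigma>" using assms by simp
    then show ?thesis
      using cov_tendsto[OF pos(1), of \<sigma>] cov_sym limit_kernel_sym by simp
  qed
  \<comment> \<open>Once \<open>N * (t - \<theta>) \<ge> 1\<close>, the cell of
    \<open>\<theta>\<close> is among those summed, that is
    \<open>\<lceil>N \<theta>\<rceil> \<le> \<lfloor>N t\<rfloor>\<close>; likewise for
    \<open>\<sigma>\<close> and \<open>s\<close>.\<close>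
  obtain n0 n1 :: nat where n: "1 / (t - \<theta>) \<le> real n0" "1 / (s - \<sigma>) \<le> real n1"
    using real_arch_simple by metis
  have "(real N)\<^sup>2 * cov N (nat \<lceil>real N * \<theta>\<rceil>) (nat \<lceil>real N * \<sigma>\<rceil>) = step N t s (\<theta>, \<sigma>)"
    if N: "N \<ge> max 1 (max n0 n1)" for N
  proof -
    have "1 / (t - \<theta>) \<le> real N" "1 / (s - \<sigma>) \<le> real N" using n N by linarith+
    then have *: "1 \<le> real N * t - real N * \<theta>" "1 \<le> real N * s - real N * \<sigma>"
      using pos by (simp_all add: field_simps)
    have "0 < real N * \<theta>" "0 < real N * \<sigma>" using N pos by auto
    then have "1 \<le> \<lceil>real N * \<theta>\<rceil>" "1 \<le> \<lceil>real N * \<sigma>\<rceil>" by linarith+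
    moreover have "\<lceil>real N * \<theta>\<rceil> \<le> \<lfloor>real N * t\<rfloor>" "\<lceil>real N * \<sigma>\<rceil> \<le> \<lfloor>real N * s\<rfloor>" using * by linarith+
    moreover have "1 \<le> N" using N by simp
    ultimately show ?thesis by (simp add: step_eq)
  qed
  then have "\<forall>\<^sub>F N in sequentially. (real N)\<^sup>2 * cov N (nat \<lceil>real N * \<theta>\<rceil>) (nat \<lceil>real N * \<sigma>\<rceil>) = step N t s (\<theta>, \<sigma>)"
    unfolding eventually_sequentially by (intro exI[of _ "max 1 (max n0 n1)"]) simp
  from Lim_transform_eventually[OF lim this] show ?thesis using True by simp
qed

section \<open>Existence of the limiting double integral\<close>

lemma limit_kernel_measurable:
  "(\<lambda>z. limit_kernel R h (fst z) (snd z)) \<in> borel_measurable (borel \<Otimes>\<^sub>M borel)"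
proof -
  have [measurable]: "h \<in> borel_measurable borel"
    by (rule borel_measurable_continuous_onI[OF h_cont])
  have "continuous_on UNIV (\<lambda>z::real \<times> real. (h (fst z), h (snd z)))"
    by (intro continuous_intros continuous_on_compose2[OF h_cont]) auto
  \<comment> \<open>\<open>R\<close> is known to be continuous on the square only, which is where
    \<open>h\<close> takes its values.\<close>
  then have "continuous_on UNIV (\<lambda>z::real \<times> real. R (h (fst z), h (snd z)))"
    using h_range by (intro continuous_on_compose2[OF R_cont]) auto
  then have [measurable]: "(\<lambda>z::real \<times> real. R (h (fst z), h (snd z))) \<in> borel_measurable (borel \<Otimes>\<^sub>M borel)"
    unfolding borel_prod by (rule borel_measurable_continuous_onI)
  have "continuous_on UNIV (\<lambda>z::real \<times> real. (h (snd z), h (fst z)))"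
    by (intro continuous_intros continuous_on_compose2[OF h_cont]) auto
  then have "continuous_on UNIV (\<lambda>z::real \<times> real. R (h (snd z), h (fst z)))"
    using h_range by (intro continuous_on_compose2[OF R_cont]) auto
  then have [measurable]: "(\<lambda>z::real \<times> real. R (h (snd z), h (fst z))) \<in> borel_measurable (borel \<Otimes>\<^sub>M borel)"
    unfolding borel_prod by (rule borel_measurable_continuous_onI)
  show ?thesis unfolding limit_kernel_def calR_def by measurable
qed

text \<open>Unlike for \<open>step\<close>, the diagonal is included, because the kernel is 0
  there.\<close>

lemma limit_kernel_bound:
  "\<exists>C\<ge>0. \<forall>t s z. \<bar>indicator ({0..t} \<times> {0..s}) z * limit_kernel R h (fst z) (snd z)\<bar> \<le> dominating C (2 * a - 2) t s z"
proof -
  obtain B where B: "0 \<le> B" "\<forall>z\<in>{a..b} \<times> {a..b}. \<bar>R z\<bar> \<le> B" using R_bounded by auto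
  have "\<bar>limit_kernel R h \<theta> \<sigma>\<bar> \<le> B * (\<bar>\<theta> - \<sigma>\<bar> powr (2 * a - 2) + 1)" for \<theta> \<sigma>
  proof -
    have "\<bar>calR R \<theta> \<sigma> (h \<theta>) (h \<sigma>)\<bar> \<le> B" using B(2) h_range by (auto simp: calR_def)
    moreover have "\<bar>\<theta> - \<sigma>\<bar> powr (h \<theta> + h \<sigma> - 2) \<le> \<bar>\<theta> - \<sigma>\<bar> powr (2 * a - 2) + 1"
      by (intro powr_between_le exponent_bounds) simp
    ultimately show ?thesis
      unfolding limit_kernel_def abs_mult using B(1) by (intro mult_mono) auto
  qed
  then show ?thesis
    using B(1) by (intro exI[of _ B]) (auto simp: dominating_def abs_mult indicator_def)
qed

lemma kernel_integrable:
  assumes "0 \<le> t" "0 \<le> s"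
  shows "integrable (lborel \<Otimes>\<^sub>M lborel)
    (\<lambda>z. indicator ({0..t} \<times> {0..s}) z * limit_kernel R h (fst z) (snd z))"
proof -
  obtain C where C: "0 \<le> C"
    "\<And>t s z. \<bar>indicator ({0..t} \<times> {0..s}) z * limit_kernel R h (fst z) (snd z)\<bar> \<le> dominating C (2 * a - 2) t s z"
    using limit_kernel_bound by auto
  note [measurable] = limit_kernel_measurable
  show ?thesis
  proof (rule Bochner_Integration.integrable_bound)
    show "integrable (lborel \<Otimes>\<^sub>M lborel) (dominating C (2 * a - 2) t s)"
      using a C(1) assms by (intro integrable_dominating) auto
    show "(\<lambda>z. indicator ({0..t} \<times> {0..s}) z * limit_kernel R h (fst z) (snd z)) \<in> borel_measurable (lborel \<Otimes>\<^sub>M lborel)"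
      by measurable
  qed (intro AE_I2, unfold real_norm_def, rule order_trans[OF C(2) abs_ge_self])
qed

lemma set_integrable_kernel:
  assumes "0 \<le> t" "0 \<le> s"
  shows "set_integrable (lborel \<Otimes>\<^sub>M lborel) ({0..t} \<times> {0..s}) (\<lambda>(\<theta>, \<sigma>). limit_kernel R h \<theta> \<sigma>)"
  using kernel_integrable[OF assms] by (simp add: set_integrable_def case_prod_beta)

text \<open>Fubini's theorem would give almost every slice; the explicit majorant gives every one.
  Taking \<open>t = \<theta>\<close> in it puts \<open>\<theta>\<close> inside its interval.\<close>

lemma set_integrable_kernel_slice:
  assumes "0 \<le> \<theta>"
  shows "set_integrable lborel {0..s} (\<lambda>\<sigma>. limit_kernel R h \<theta> \<sigma>)"
proof -
  obtain C where C: "0 \<le> C"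
    "\<And>t s z. \<bar>indicator ({0..t} \<times> {0..s}) z * limit_kernel R h (fst z) (snd z)\<bar> \<le> dominating C (2 * a - 2) t s z"
    using limit_kernel_bound by auto
  have [measurable]: "(\<lambda>\<sigma>. limit_kernel R h \<theta> \<sigma>) \<in> borel_measurable borel"
    using measurable_compose[OF measurable_Pair1' limit_kernel_measurable, of \<theta>] by simp
  show ?thesis unfolding set_integrable_def
  proof (rule Bochner_Integration.integrable_bound)
    show "integrable lborel (\<lambda>\<sigma>. dominating C (2 * a - 2) \<theta> s (\<theta>, \<sigma>))"
      using a by (intro integrable_dominating_slice) auto
    have "norm (indicator {0..s} \<sigma> *\<^sub>R limit_kernel R h \<theta> \<sigma>) \<le> norm (dominating C (2 * a - 2) \<theta> s (\<theta>, \<sigma>))" for \<sigma>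
      using order_trans[OF C(2)[of \<theta> s "(\<theta>, \<sigma>)"] abs_ge_self] assms by (simp add: indicator_times)
    then show "AE \<sigma> in lborel. norm (indicator {0..s} \<sigma> *\<^sub>R limit_kernel R h \<theta> \<sigma>) \<le> norm (dominating C (2 * a - 2) \<theta> s (\<theta>, \<sigma>))"
      by simp
  qed measurable
qed

lemma kernel_iterated:
  assumes "0 \<le> t" "0 \<le> s"
  shows "set_integrable lborel {0..t} (\<lambda>\<theta>. LINT \<sigma>:{0..s}|lborel. limit_kernel R h \<theta> \<sigma>)"
    and "(LINT \<theta>:{0..t}|lborel. LINT \<sigma>:{0..s}|lborel. limit_kernel R h \<theta> \<sigma>) =
      (LINT z|(lborel \<Otimes>\<^sub>M lborel). indicator ({0..t} \<times> {0..s}) z * limit_kernel R h (fst z) (snd z))"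
proof -
  have eq: "(LINT \<sigma>|lborel. indicator ({0..t} \<times> {0..s}) (\<theta>, \<sigma>) * limit_kernel R h (fst (\<theta>, \<sigma>)) (snd (\<theta>, \<sigma>)))
      = indicator {0..t} \<theta> *\<^sub>R (LINT \<sigma>:{0..s}|lborel. limit_kernel R h \<theta> \<sigma>)" for \<theta>
    by (simp add: set_lebesgue_integral_def indicator_times mult.assoc)
  show "set_integrable lborel {0..t} (\<lambda>\<theta>. LINT \<sigma>:{0..s}|lborel. limit_kernel R h \<theta> \<sigma>)"
    using lborel_pair.integrable_fst'[OF kernel_integrable[OF assms]] unfolding set_integrable_def eq .
  show "(LINT \<theta>:{0..t}|lborel. LINT \<sigma>:{0..s}|lborel. limit_kernel R h \<theta> \<sigma>) =
      (LINT z|(lborel \<Otimes>\<^sub>M lborel). indicator ({0..t} \<times> {0..s}) z * limit_kernel R h (fst z) (snd z))"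
    using lborel_pair.integral_fst'[OF kernel_integrable[OF assms]]
    unfolding eq set_lebesgue_integral_def[of lborel "{0..t}"] .
qed

theorem sum_cov_tendsto:
  assumes "0 \<le> t" "0 \<le> s"
  shows "(\<lambda>N. \<Sum>n = 1..nat \<lfloor>real N * t\<rfloor>. \<Sum>m = 1..nat \<lfloor>real N * s\<rfloor>. cov N n m) \<longlonglongrightarrow>
    (LINT \<theta>:{0..t}|lborel. LINT \<sigma>:{0..s}|lborel. limit_kernel R h \<theta> \<sigma>)"
proof -
  obtain C where C: "0 \<le> C"
    "\<forall>N\<ge>1. \<forall>t s z. fst z \<noteq> snd z \<longrightarrow> \<bar>step N t s z\<bar> \<le> dominating C (2 * a - 2) t s z"
    using step_bound by auto
  note [measurable] = limit_kernel_measurable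
  have [measurable]: "cell N n \<in> sets borel" for N n by (simp add: cell_def)
  have AE1: "AE \<theta> in lborel. \<theta> \<notin> {0, t}" for t :: real
    using AE_lborel_singleton[of "0::real"] AE_lborel_singleton[of t] by eventually_elim auto
  \<comment> \<open>For almost every \<open>\<theta>\<close> the exceptional lines meet the slice in
    at most three points, \<open>\<theta>\<close>, 0 and \<open>s\<close>.\<close>
  have "AE \<theta> in lborel. AE \<sigma> in lborel. \<theta> \<noteq> \<sigma> \<and> \<theta> \<notin> {0, t} \<and> \<sigma> \<notin> {0, s}"
    using AE1[of t]
  proof eventually_elim
    case (elim \<theta>)
    show ?case using AE1[of s] AE_lborel_singleton[of \<theta>] by eventually_elim (use elim in auto)
  qed
  moreover have "{z \<in> space (lborel \<Otimes>\<^sub>M lborel). fst z \<noteq> snd z \<and> fst z \<notin> {0, t} \<and> snd z \<notin> {0, s}}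
      \<in> sets (lborel \<Otimes>\<^sub>M lborel)"
    by measurable
  ultimately have AE: "AE z in lborel \<Otimes>\<^sub>M lborel. fst z \<noteq> snd z \<and> fst z \<notin> {0, t} \<and> snd z \<notin> {0, s}"
    by (intro lborel_pair.AE_pair_measure) (simp_all only: fst_conv snd_conv)
  have "(\<lambda>N. LINT z|(lborel \<Otimes>\<^sub>M lborel). step N t s z) \<longlonglongrightarrow>
      (LINT z|(lborel \<Otimes>\<^sub>M lborel). indicator ({0..t} \<times> {0..s}) z * limit_kernel R h (fst z) (snd z))"
  proof (rule integral_dominated_convergence)
    show "integrable (lborel \<Otimes>\<^sub>M lborel) (dominating C (2 * a - 2) t s)"
      using a C(1) assms by (intro integrable_dominating) auto
    show "step N t s \<in> borel_measurable (lborel \<Otimes>\<^sub>M lborel)" for N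
      unfolding step_def[abs_def] by measurable
    show "AE z in lborel \<Otimes>\<^sub>M lborel. (\<lambda>N. step N t s z) \<longlonglongrightarrow>
        indicator ({0..t} \<times> {0..s}) z * limit_kernel R h (fst z) (snd z)"
      using AE
    proof eventually_elim
      case (elim z)
      then show ?case using step_tendsto[of "fst z" "snd z" t s] by simp
    qed
    show "AE z in lborel \<Otimes>\<^sub>M lborel. norm (step N t s z) \<le> dominating C (2 * a - 2) t s z" for N
    proof (cases "1 \<le> N")
      case True
      show ?thesis using AE by eventually_elim (use C(2) True in auto)
    next
      case False
      \<comment> \<open>The domination is required for all \<open>N\<close>; at 0 the step function
        is an empty sum.\<close>
      then have "N = 0" by simp
      then show ?thesis using C(1) by (simp add: step_def dominating_def)
    qed
  qed measurable
  moreover have "\<forall>\<^sub>F N in sequentially. (LINT z|(lborel \<Otimes>\<^sub>M lborel). step N t s z) =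
      (\<Sum>n = 1..nat \<lfloor>real N * t\<rfloor>. \<Sum>m = 1..nat \<lfloor>real N * s\<rfloor>. cov N n m)"
    unfolding eventually_sequentially by (intro exI[of _ 1] allI impI LINT_step)
  ultimately show ?thesis
    unfolding kernel_iterated(2)[OF assms] by (rule Lim_transform_eventually)
qed

end

section \<open>The partial sum process\<close>

text \<open>Exchanging the sums over times and indices leaves one coefficient per \<open>n\<close>.
  Distinct \<open>n\<close> give distinct field indices \<open>(n, h (n/N))\<close>, so this is a
  finite linear combination of the field.\<close>

lemma partial_sum_process_lin_comb_gaussian:
  fixes X :: "nat \<Rightarrow> real \<Rightarrow> 'w \<Rightarrow> real"
  assumes field: "centered_gaussian_field P ({1..} \<times> H) (\<lambda>(n, H). X n H)"
    and h: "\<And>x. h x \<in> H" and J: "finite J"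
  shows "centered_gaussian_rv P (\<lambda>\<omega>. \<Sum>t\<in>J. u t * partial_sum_process X h N t \<omega>)"
proof -
  define k where "k t = nat \<lfloor>real N * t\<rfloor>" for t
  \<comment> \<open>A crude common upper limit for all the sums; surplus terms get coefficient
    0.\<close>
  define L where "L = (\<Sum>t\<in>J. k t)"
  define ix where "ix n = (n, h (real n / real N))" for n
  define c where "c = (\<lambda>(n, H). (\<Sum>t\<in>J. if n \<le> k t then u t else 0) / real N powr H)"
  have "(\<Sum>t\<in>J. u t * partial_sum_process X h N t \<omega>) = (\<Sum>i\<in>ix ` {1..L}. c i * (case i of (n, H) \<Rightarrow> X n H) \<omega>)" for \<omega>
  proof -
    define x where "x n = X n (h (real n / real N)) \<omega> / real N powr h (real n / real N)" for n
    have "partial_sum_process X h N t \<omega> = (\<Sum>n=1..L. if n \<le> k t then x n else 0)" if "t \<in> J" for t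
    proof -
      have "k t \<le> L" unfolding L_def using J that by (intro member_le_sum) auto
      then have "(\<Sum>n=1..L. if n \<le> k t then x n else 0) = (\<Sum>n=1..k t. x n)"
        by (intro sum.mono_neutral_cong_right) auto
      then show ?thesis by (simp add: partial_sum_process_def k_def x_def)
    qed
    then have "(\<Sum>t\<in>J. u t * partial_sum_process X h N t \<omega>) =
        (\<Sum>t\<in>J. \<Sum>n=1..L. u t * (if n \<le> k t then x n else 0))"
      by (intro sum.cong) (auto simp: sum_distrib_left)
    also have "\<dots> = (\<Sum>n=1..L. \<Sum>t\<in>J. u t * (if n \<le> k t then x n else 0))" by (rule sum.swap)
    also have "\<dots> = (\<Sum>n=1..L. (\<Sum>t\<in>J. if n \<le> k t then u t else 0) * x n)"
      unfolding sum_distrib_right by (intro sum.cong refl) simp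
    also have "\<dots> = (\<Sum>n=1..L. c (ix n) * (case ix n of (n, H) \<Rightarrow> X n H) \<omega>)"
      by (simp add: c_def ix_def x_def)
    also have "\<dots> = (\<Sum>i\<in>ix ` {1..L}. c i * (case i of (n, H) \<Rightarrow> X n H) \<omega>)"
      by (subst sum.reindex) (auto simp: ix_def inj_on_def)
    finally show ?thesis .
  qed
  moreover have "ix ` {1..L} \<subseteq> {1..} \<times> H" using h by (auto simp: ix_def)
  ultimately show ?thesis
    using field unfolding centered_gaussian_field_def by simp
qed

lemma centered_gaussian_field_coordinate:
  assumes "centered_gaussian_field M I Y" "i \<in> I"
  shows "centered_gaussian_rv M (Y i)"
  using assms(1)[unfolded centered_gaussian_field_def, rule_format, of "{i}" "\<lambda>_. 1"] assms(2) by simp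

lemma LINT_partial_sum_process_mult:
  fixes X :: "nat \<Rightarrow> real \<Rightarrow> 'w \<Rightarrow> real"
  assumes field: "centered_gaussian_field P ({1..} \<times> H) (\<lambda>(n, H). X n H)" and h: "\<And>x. h x \<in> H"
  shows "(LINT \<omega>|P. partial_sum_process X h N t \<omega> * partial_sum_process X h N s \<omega>) =
    (\<Sum>n = 1..nat \<lfloor>real N * t\<rfloor>. \<Sum>m = 1..nat \<lfloor>real N * s\<rfloor>.
      (LINT \<omega>|P. X n (h (real n / real N)) \<omega> * X m (h (real m / real N)) \<omega>) /
        real N powr (h (real n / real N) + h (real m / real N)))"
proof -
  define x where "x n \<omega> = X n (h (real n / real N)) \<omega>" for n \<omega>
  define w where "w n = real N powr h (real n / real N)" for n
  have gauss: "centered_gaussian_rv P (x n)" if "1 \<le> n" for n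
    using centered_gaussian_field_coordinate[OF field, of "(n, h (real n / real N))"] that h
    by (simp add: x_def[abs_def])
  have int: "integrable P (\<lambda>\<omega>. x n \<omega> * x m \<omega>)" if "1 \<le> n" "1 \<le> m" for n m
    using gauss[OF that(1)] gauss[OF that(2)]
    by (intro integrable_mult_of_square_integrable centered_gaussian_rv_second_moment(1))
      (auto simp: centered_gaussian_rv_def)
  have eq: "x n \<omega> / w n * (x m \<omega> / w m) = (x n \<omega> * x m \<omega>) / (w n * w m)" for n m \<omega>
    by simp
  have int': "integrable P (\<lambda>\<omega>. x n \<omega> / w n * (x m \<omega> / w m))" if "n \<in> {1..k}" "m \<in> {1..l}" for n m k l
    unfolding eq using int that by (intro integrable_divide_zero) auto
  have "(LINT \<omega>|P. partial_sum_process X h N t \<omega> * partial_sum_process X h N s \<omega>) =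
      (\<Sum>n = 1..nat \<lfloor>real N * t\<rfloor>. \<Sum>m = 1..nat \<lfloor>real N * s\<rfloor>. LINT \<omega>|P. x n \<omega> / w n * (x m \<omega> / w m))"
    unfolding partial_sum_process_def x_def[symmetric] w_def[symmetric]
    by (rule LINT_sum_mult_sum[OF int'])
  then show ?thesis
    unfolding eq integral_divide_zero by (simp add: x_def w_def powr_add)
qed

theorem theorem2:
  fixes a b :: real
    and h :: "real \<Rightarrow> real"
    and P :: "'w measure"
    and X :: "nat \<Rightarrow> real \<Rightarrow> 'w \<Rightarrow> real"
    and R :: "real \<times> real \<Rightarrow> real"
  assumes "1 / 2 < a" and "a \<le> b" and "b < 1"
    and "continuous_on UNIV h" and "\<And>x. h x \<in> {a..b}"
    and "prob_space P"
    and "centered_gaussian_field P ({1..} \<times> {1/2<..<1}) (\<lambda>(n, H). X n H)"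
    and "assumption_i P a b X"
    and "assumption_ii P a b X R"
  shows "(\<forall>t\<ge>0. \<forall>s\<ge>0.
            set_integrable (lborel \<Otimes>\<^sub>M lborel) ({0..t} \<times> {0..s}) (\<lambda>(\<theta>, \<sigma>). limit_kernel R h \<theta> \<sigma>) \<and>
            (\<forall>\<theta>\<in>{0..t}. set_integrable lborel {0..s} (\<lambda>\<sigma>. limit_kernel R h \<theta> \<sigma>)) \<and>
            set_integrable lborel {0..t} (\<lambda>\<theta>. LINT \<sigma>:{0..s}|lborel. limit_kernel R h \<theta> \<sigma>)) \<and>
         (\<exists>(Q :: (real \<Rightarrow> real) measure) S.
            prob_space Q \<and>
            centered_gaussian_field Q {0..} S \<and>
            (\<forall>t\<ge>0. \<forall>s\<ge>0.
               prob_space.expectation Q (\<lambda>\<omega>. S t \<omega> * S s \<omega>) =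
                 (LINT \<theta>:{0..t}|lborel. LINT \<sigma>:{0..s}|lborel. limit_kernel R h \<theta> \<sigma>)) \<and>
            fdd_converges {0..} P (partial_sum_process X h) Q S)"
proof (intro conjI)
  define r where "r j k H1 H2 = (LINT \<omega>|P. X j H1 \<omega> * X k H2 \<omega>)" for j k H1 H2
  interpret long_range_covariance a b h R r
  proof
    show "r j k H1 H2 = r k j H2 H1" for j k H1 H2
      unfolding r_def by (simp only: mult.commute)
    show "continuous_on ({a..b} \<times> {a..b}) R"
      using assms(9) by (simp only: assumption_ii_def)
    fix M :: real assume "0 < M"
    then have "bounded ((\<lambda>(j, k, H1, H2). r j k H1 H2) `
         {(j, k, H1, H2). 1 \<le> j \<and> 1 \<le> k \<and> \<bar>real j - real k\<bar> \<le> M \<and> H1 \<in> {a..b} \<and> H2 \<in> {a..b}})"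
      using assms(8) unfolding assumption_i_def r_def by blast
    then obtain B where B: "\<forall>x\<in>(\<lambda>(j, k, H1, H2). r j k H1 H2) `
         {(j, k, H1, H2). 1 \<le> j \<and> 1 \<le> k \<and> \<bar>real j - real k\<bar> \<le> M \<and> H1 \<in> {a..b} \<and> H2 \<in> {a..b}}. norm x \<le> B"
      unfolding bounded_iff by (elim exE)
    show "\<exists>B. \<forall>j\<ge>1. \<forall>k\<ge>1. \<bar>real j - real k\<bar> \<le> M \<longrightarrow> (\<forall>H1\<in>{a..b}. \<forall>H2\<in>{a..b}. \<bar>r j k H1 H2\<bar> \<le> B)"
    proof (intro exI[of _ B] allI impI ballI)
      fix j k :: nat and H1 H2
      assume "1 \<le> j" "1 \<le> k" "\<bar>real j - real k\<bar> \<le> M" "H1 \<in> {a..b}" "H2 \<in> {a..b}"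
      then show "\<bar>r j k H1 H2\<bar> \<le> B"
        by (intro B[rule_format, unfolded real_norm_def] image_eqI[of _ _ "(j, k, H1, H2)"]) auto
    qed
  next
    fix \<eta> :: real assume "0 < \<eta>"
    then show "\<exists>M>0. \<forall>j\<ge>1. \<forall>k\<ge>1. real j - real k \<ge> M \<longrightarrow>
      (\<forall>H1\<in>{a..b}. \<forall>H2\<in>{a..b}.
        \<bar>(real j - real k) powr (2 - H1 - H2) * r j k H1 H2 - R (H1, H2)\<bar> \<le> \<eta>)"
      using assms(9) unfolding assumption_ii_def r_def by (elim conjE allE[of _ \<eta>] impE)
  qed (fact assms)+
  \<comment> \<open>The integral of a non-integrable function defaults to 0, so the covariance
    formula alone would not express that its right-hand side is well defined.\<close>
  show "\<forall>t\<ge>0. \<forall>s\<ge>0.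
      set_integrable (lborel \<Otimes>\<^sub>M lborel) ({0..t} \<times> {0..s}) (\<lambda>(\<theta>, \<sigma>). limit_kernel R h \<theta> \<sigma>) \<and>
      (\<forall>\<theta>\<in>{0..t}. set_integrable lborel {0..s} (\<lambda>\<sigma>. limit_kernel R h \<theta> \<sigma>)) \<and>
      set_integrable lborel {0..t} (\<lambda>\<theta>. LINT \<sigma>:{0..s}|lborel. limit_kernel R h \<theta> \<sigma>)"
    using set_integrable_kernel set_integrable_kernel_slice kernel_iterated(1) by auto
  define K where "K t s = (LINT \<theta>:{0..t}|lborel. LINT \<sigma>:{0..s}|lborel. limit_kernel R h \<theta> \<sigma>)" for t s
  let ?S = "partial_sum_process X h"
  have h12: "h x \<in> {1/2<..<1}" for x using h_bounds[of x] a b by auto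
  have gauss: "centered_gaussian_rv P (\<lambda>\<omega>. \<Sum>t\<in>J. u t * ?S N t \<omega>)" if "finite J" for J u N
    by (rule partial_sum_process_lin_comb_gaussian[OF assms(7) h12 that])
  have lim: "(\<lambda>N. LINT \<omega>|P. ?S N t \<omega> * ?S N s \<omega>) \<longlonglongrightarrow> K t s" if "0 \<le> t" "0 \<le> s" for t s
    using sum_cov_tendsto[OF that]
    unfolding LINT_partial_sum_process_mult[OF assms(7) h12] cov_def r_def K_def .
  \<comment> \<open>Symmetry passes to the limit from the covariances, without exchanging the order
    of integration.\<close>
  have sym: "K t s = K s t" if "t \<in> {0..}" "s \<in> {0..}" for t s
  proof (rule LIMSEQ_unique)
    show "(\<lambda>N. LINT \<omega>|P. ?S N t \<omega> * ?S N s \<omega>) \<longlonglongrightarrow> K t s" using lim that by simp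
    have "(\<lambda>N. LINT \<omega>|P. ?S N s \<omega> * ?S N t \<omega>) \<longlonglongrightarrow> K s t" using lim that by simp
    then show "(\<lambda>N. LINT \<omega>|P. ?S N t \<omega> * ?S N s \<omega>) \<longlonglongrightarrow> K s t" by (simp only: mult.commute)
  qed
  have psd: "0 \<le> quad_form K J c" if J: "finite J" "J \<subseteq> {0..}" for J c
  proof (rule LIMSEQ_le_const)
    show "(\<lambda>N. quad_form (\<lambda>t s. LINT \<omega>|P. ?S N t \<omega> * ?S N s \<omega>) J c) \<longlonglongrightarrow> quad_form K J c"
      unfolding quad_form_def using J by (intro tendsto_intros lim) auto
    have "0 \<le> quad_form (\<lambda>t s. LINT \<omega>|P. ?S N t \<omega> * ?S N s \<omega>) J c" for N
    proof -
      have "quad_form (\<lambda>t s. LINT \<omega>|P. ?S N t \<omega> * ?S N s \<omega>) J c = (LINT \<omega>|P. (\<Sum>t\<in>J. c t * ?S N t \<omega>)\<^sup>2)"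
        by (intro LINT_lin_comb_squared[symmetric] lin_combs_gaussian_imp_coordinates(3)[OF J(1) gauss[OF J(1)]])
      then show ?thesis by simp
    qed
    then show "\<exists>n. \<forall>N\<ge>n. 0 \<le> quad_form (\<lambda>t s. LINT \<omega>|P. ?S N t \<omega> * ?S N s \<omega>) J c" by blast
  qed
  obtain Q :: "(real \<Rightarrow> real) measure" where Q: "prob_space Q"
    "centered_gaussian_field Q {0..} (\<lambda>t \<omega>. \<omega> t)"
    and cov_Q: "\<And>t s. t \<in> {0..} \<Longrightarrow> s \<in> {0..} \<Longrightarrow> (LINT \<omega>|Q. \<omega> t * \<omega> s) = K t s"
  proof (rule ex_centered_gaussian_field[of "{0..}" K])
    show "K t s = K s t" if "t \<in> {0..}" "s \<in> {0..}" for t s using that by (rule sym)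
    show "0 \<le> quad_form K J c" if "finite J" "J \<subseteq> {0..}" for J c using that by (rule psd)
  qed (rule that)
  have "fdd_converges {0..} P ?S Q (\<lambda>t \<omega>. \<omega> t)"
    unfolding fdd_converges_def
  proof (intro allI impI, elim conjE)
    fix J :: "real set" assume J: "finite J" "J \<subseteq> {0..}"
    show "weakly_converges J (\<lambda>N. fin_dim_law P (?S N) J) (fin_dim_law Q (\<lambda>t \<omega>. \<omega> t) J)"
    proof (rule weakly_converges_gaussian[OF J(1) assms(6) Q(1) gauss[OF J(1)]])
      show "centered_gaussian_rv Q (\<lambda>\<omega>. \<Sum>j\<in>J. u j * \<omega> j)" for u
        using Q(2) J by (simp add: centered_gaussian_field_def)
      show "(\<lambda>N. LINT \<omega>|P. ?S N i \<omega> * ?S N j \<omega>) \<longlonglongrightarrow> (LINT \<omega>|Q. \<omega> i * \<omega> j)" if "i \<in> J" "j \<in> J" for i j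
      proof -
        have "i \<in> {0..}" "j \<in> {0..}" using that J by auto
        then show ?thesis using lim[of i j] cov_Q[of i j] by simp
      qed
    qed
  qed
  then show "\<exists>(Q :: (real \<Rightarrow> real) measure) S.
      prob_space Q \<and> centered_gaussian_field Q {0..} S \<and>
      (\<forall>t\<ge>0. \<forall>s\<ge>0. prob_space.expectation Q (\<lambda>\<omega>. S t \<omega> * S s \<omega>) =
         (LINT \<theta>:{0..t}|lborel. LINT \<sigma>:{0..s}|lborel. limit_kernel R h \<theta> \<sigma>)) \<and>
      fdd_converges {0..} P ?S Q S"
    using Q cov_Q by (intro exI[of _ Q] exI[of _ "\<lambda>t \<omega>. \<omega> t"]) (auto simp: K_def)
qed

end
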